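(* Let $\mathcal{K}$ be a finite-dimensional real Hilbert space, let $\mathcal{M}_1,\mathcal{M}_2\subset\mathcal{K}$ be closed sets, and let $A\in\mathcal{M}_1\cap\mathcal{M}_2$ be a non-tangential point (with smoothness class $C^2$). Then there exists $s>0$ such that for every $B\in\mathcal{K}$ with $\|B-A\|<s$ the sequence of alternating projections defined by $B_0=B$ and $$B_{k+1}=\begin{cases}\pi_1(B_k), & k \text{ even},\\ \pi_2(B_k), & k\text{ odd},\end{cases}$$ converges to a point $B_\infty\in\mathcal{M}_1\cap\mathcal{M}_2$. Moreover, given any $\epsilon>0$, one can choose $s>0$ such that in addition $$\|B_\infty-\pi(B)\|<\epsilon\,\|B-\pi(B)\|$$ for every $B\notin\mathcal{M}_1\cap\mathcal{M}_2$ with $\|B-A\|<s$.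
   Context: Local manifolds: a set $\mathcal{M}\subset\mathcal{K}$ is locally an $m$-dimensional $C^p$-manifold around (at) $A\in\mathcal{M}$ if there are $r_1>0$ and a $C^p$-map $\phi:\{x\in\mathbb{R}^m:\|x\|<r_1\}\to\mathcal{K}$ such that $d\phi(x)$ is injective for all $x$, $\phi(0)=A$, and $\phi$ is a homeomorphism onto an open neighborhood of $A$ in $\mathcal{M}$ (with the topology induced from $\mathcal{K}$). For $B=\phi(x)$ the tangent space is the linear subspace $T_{\mathcal{M}}(B)=\mathrm{Ran}\, d\phi(x)$. Regular point (class $C^p$, $p\ge 1$): a point $A\in\mathcal{M}_1\cap\mathcal{M}_2$ such that, for some integers $m_1,m_2,m$, each $\mathcal{M}_j$ is locally an $m_j$-dimensional $C^p$-manifold at $A$ ($j=1,2$), and $\mathcal{M}_1\cap\mathcal{M}_2$ is locally an $m$-dimensional $C^p$-manifold at $A$. Here $p=2$. For a regular point $A$ put $$\sigma(A)=\lim_{r\to0}\sup\left\{\frac{\langle B_1-A,B_2-A\rangle}{\|B_1-A\|\,\|B_2-A\|}: B_j\in\mathcal{M}_j,\ 0<\|B_j-A\|<r,\ B_j-A\perp T_{\mathcal{M}_1\cap\mathcal{M}_2}(A),\ j=1,2\right\},$$ with the supremum of the empty set taken to be $0$. The point $A$ is non-tangential if it is regular and $\sigma(A)<1$. Projections: $\pi_1(B),\pi_2(B),\pi(B)$ denote the unique closest point to $B$ in $\mathcal{M}_1$, $\mathcal{M}_2$ and $\mathcal{M}_1\cap\mathcal{M}_2$, respectively. These are well defined for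 all points sufficiently near $A$, and $s$ is understood to be small enough that all projections occurring are well defined. *)

theory Defs
  imports "HOL-Analysis.Analysis"
begin

text \<open>
  \<open>C\<^sup>k\<close> maps on a relatively open subset \<open>S\<close> of a linear subspace \<open>V\<close>. The derivative at a point
  \<open>x \<in> S\<close> is taken within \<open>S\<close>, so it is determined on \<open>V\<close> only and is used only on \<open>V\<close>.
  As \<open>V\<close> has finite dimension, \<open>df\<close> is \<open>C\<^sup>k\<close> iff \<open>x \<mapsto> df(x) v\<close> is \<open>C\<^sup>k\<close> for every
  direction \<open>v \<in> V\<close>.
\<close>

primrec Ck_on ::
  "nat \<Rightarrow> 'a::euclidean_space set \<Rightarrow> 'a set \<Rightarrow> ('a \<Rightarrow> 'b::euclidean_space) \<Rightarrow> bool" where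
  "Ck_on 0 V S f \<longleftrightarrow> continuous_on S f"
| "Ck_on (Suc k) V S f \<longleftrightarrow>
     f differentiable_on S \<and>
     (\<forall>v\<in>V. Ck_on k V S (\<lambda>x. frechet_derivative f (at x within S) v))"

text \<open>
  A \<open>C\<^sup>p\<close> chart (\<open>p \<ge> 1\<close>) of dimension \<open>m\<close> of the set \<open>M\<close>, centred at \<open>A\<close>. The parameter
  space \<open>\<real>\<^sup>m\<close> is an \<open>m\<close>-dimensional linear subspace \<open>V\<close> of the ambient Euclidean space:
  injectivity of the derivative \<open>\<real>\<^sup>m \<rightarrow> K\<close> forces \<open>m \<le> dim K\<close>, so \<open>\<real>\<^sup>m\<close> is isometric to
  such a subspace. The case \<open>m = 0\<close> (\<open>V = {0}\<close>, \<open>A\<close> isolated in \<open>M\<close>) is included.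
\<close>

definition local_chart ::
  "nat \<Rightarrow> nat \<Rightarrow> 'a::euclidean_space set \<Rightarrow> 'a \<Rightarrow> 'a set \<Rightarrow> real \<Rightarrow> ('a \<Rightarrow> 'a) \<Rightarrow> bool" where
  "local_chart p m M A V r \<phi> \<longleftrightarrow>
     subspace V \<and> dim V = m \<and> r > 0 \<and>
     (let S = V \<inter> ball 0 r in
        Ck_on p V S \<phi> \<and>
        (\<forall>x\<in>S. inj_on (frechet_derivative \<phi> (at x within S)) V) \<and>
        \<phi> 0 = A \<and>
        openin (top_of_set M) (\<phi> ` S) \<and>
        (\<exists>\<psi>. homeomorphism S (\<phi> ` S) \<phi> \<psi>))"

definition locally_manifold_at ::
  "nat \<Rightarrow> nat \<Rightarrow> 'a::euclidean_space set \<Rightarrow> 'a \<Rightarrow> bool" where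
  "locally_manifold_at p m M A \<longleftrightarrow> (\<exists>V r \<phi>. local_chart p m M A V r \<phi>)"

text \<open>The range below does not depend on the chart, hence not on the choice made.\<close>

definition tangent_space ::
  "nat \<Rightarrow> 'a::euclidean_space set \<Rightarrow> 'a \<Rightarrow> 'a set" where
  "tangent_space p M A =
     (SOME T. \<exists>m V r \<phi>. local_chart p m M A V r \<phi> \<and>
        T = frechet_derivative \<phi> (at 0 within V \<inter> ball 0 r) ` V)"

definition regular_point ::
  "nat \<Rightarrow> 'a::euclidean_space set \<Rightarrow> 'a set \<Rightarrow> 'a \<Rightarrow> bool" where
  "regular_point p M1 M2 A \<longleftrightarrow>
     A \<in> M1 \<inter> M2 \<and>
     (\<exists>m1 m2 m. locally_manifold_at p m1 M1 A \<and>
                locally_manifold_at p m2 M2 A \<and>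
                locally_manifold_at p m (M1 \<inter> M2) A)"

definition angle_cosines ::
  "nat \<Rightarrow> 'a::euclidean_space set \<Rightarrow> 'a set \<Rightarrow> 'a \<Rightarrow> real \<Rightarrow> real set" where
  "angle_cosines p M1 M2 A r =
     {((B1 - A) \<bullet> (B2 - A)) / (norm (B1 - A) * norm (B2 - A)) | B1 B2.
        B1 \<in> M1 \<and> 0 < norm (B1 - A) \<and> norm (B1 - A) < r \<and>
        B1 - A \<in> orthogonal_comp (tangent_space p (M1 \<inter> M2) A) \<and>
        B2 \<in> M2 \<and> 0 < norm (B2 - A) \<and> norm (B2 - A) < r \<and>
        B2 - A \<in> orthogonal_comp (tangent_space p (M1 \<inter> M2) A)}"

definition cos_angle ::
  "nat \<Rightarrow> 'a::euclidean_space set \<Rightarrow> 'a set \<Rightarrow> 'a \<Rightarrow> real" where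
  "cos_angle p M1 M2 A =
     Lim (at_right 0)
       (\<lambda>r. let X = angle_cosines p M1 M2 A r in if X = {} then 0 else Sup X)"

definition non_tangential ::
  "nat \<Rightarrow> 'a::euclidean_space set \<Rightarrow> 'a set \<Rightarrow> 'a \<Rightarrow> bool" where
  "non_tangential p M1 M2 A \<longleftrightarrow> regular_point p M1 M2 A \<and> cos_angle p M1 M2 A < 1"

text \<open>
  \<^const>\<open>closest_point\<close> is the metric projection at those points where the projection
  is well defined in the following sense.
\<close>

definition proj_well_defined :: "'a::euclidean_space set \<Rightarrow> 'a \<Rightarrow> bool" where
  "proj_well_defined M B \<longleftrightarrow> (\<exists>!x. x \<in> M \<and> (\<forall>y\<in>M. dist B x \<le> dist B y))"

primrec alt_proj ::
  "'a::euclidean_space set \<Rightarrow> 'a set \<Rightarrow> 'a \<Rightarrow> nat \<Rightarrow> 'a" where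
  "alt_proj M1 M2 B 0 = B"
| "alt_proj M1 M2 B (Suc k) =
     closest_point (if even k then M1 else M2) (alt_proj M1 M2 B k)"

definition alt_proj_well_defined ::
  "'a::euclidean_space set \<Rightarrow> 'a set \<Rightarrow> 'a \<Rightarrow> bool" where
  "alt_proj_well_defined M1 M2 B \<longleftrightarrow>
     (\<forall>k. proj_well_defined (if even k then M1 else M2) (alt_proj M1 M2 B k))"

end

theory Submission
  imports Defs
begin

text \<open>
  Everything is measured against the three fixed tangent spaces \<open>T \<subseteq> T\<^sub>1, T\<^sub>2\<close> at \<open>A\<close>. Near \<open>A\<close>,
  secants of each manifold are almost parallel to its tangent space and vectors \<open>B - \<pi>(B)\<close> are
  almost orthogonal to it, with relative error \<open>\<delta>\<close>. So if \<open>z\<close> is the point of the intersection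
  nearest to an iterate \<open>B\<close> and \<open>w = B - z\<close>, then one projection onto the first manifold replaces
  \<open>w\<close> by \<open>P\<^sub>1 w\<close> up to \<open>O(\<delta>)\<parallel>w\<parallel>\<close>, and \<open>P\<^sub>1 w\<close> is still almost orthogonal to \<open>T\<close>: the nearest point
  moves by only \<open>O(\<delta>)\<parallel>w\<parallel>\<close>. If \<open>B\<close> lies on the second manifold, \<open>w\<close> is almost in
  \<open>T\<^sub>2 \<inter> T\<^sup>\<bottom>\<close>, so the angle condition makes \<open>w \<mapsto> P\<^sub>1 w\<close> a contraction. The distances to the
  intersection thus decay geometrically, and the displacements of the nearest points sum up to
  \<open>O(\<delta>)\<parallel>B - \<pi>(B)\<parallel>\<close>. The \<open>C\<^sup>2\<close> hypothesis is needed only for uniqueness of nearest points.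
\<close>

section \<open>Orthogonal projections onto subspaces\<close>

text \<open>For a subspace the two pointwise conditions already determine the value
  (\<open>orthoproj_unique\<close>), so the choice is harmless. Linearity is part of the description
  so that it can be read off together with them.\<close>

definition orthoproj :: "'a::euclidean_space set \<Rightarrow> 'a \<Rightarrow> 'a" where
  "orthoproj V = (SOME P. linear P \<and> (\<forall>x. P x \<in> V \<and> (\<forall>v\<in>V. (x - P x) \<bullet> v = 0)))"

text \<open>The witness is the Fourier sum over an orthonormal basis \<open>E\<close>. Orthogonality
  of the residual to the members of \<open>E\<close> extends to their span, which is
  \<open>V\<close>.\<close>

lemma orthoproj_exists:
  fixes V :: "'a::euclidean_space set"
  assumes "subspace V"
  shows "\<exists>P. linear P \<and> (\<forall>x. P x \<in> V \<and> (\<forall>v\<in>V. (x - P x) \<bullet> v = 0))"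
proof -
  obtain E where E: "E \<subseteq> V" "pairwise orthogonal E" "\<And>x. x \<in> E \<Longrightarrow> norm x = 1"
      "independent E" "card E = dim V" "span E = V"
    by (rule orthonormal_basis_subspace[OF assms]) (rule that)
  have fin: "finite E"
    using E(4) independent_bound by blast
  define P where "P x = (\<Sum>e\<in>E. (x \<bullet> e) *\<^sub>R e)" for x :: 'a
  have lin: "linear P"
    unfolding P_def
    by (rule linearI)
       (simp_all add: inner_add_left scaleR_add_left sum.distrib scaleR_sum_right)
  have mem: "P x \<in> V" for x
    unfolding P_def using E(1) by (intro subspace_sum[OF assms] subspace_scale[OF assms]) blast
  have orth_e: "(x - P x) \<bullet> e = 0" if "e \<in> E" for x e
  proof -
    have "P x \<bullet> e = (\<Sum>e'\<in>E. if e' = e then x \<bullet> e else 0)"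
      unfolding P_def inner_sum_left
    proof (rule sum.cong[OF refl])
      fix e' assume "e' \<in> E"
      then show "((x \<bullet> e') *\<^sub>R e') \<bullet> e = (if e' = e then x \<bullet> e else 0)"
        using pairwiseD[OF E(2) _ that] E(3)[OF that] that
        by (simp add: orthogonal_def dot_square_norm)
    qed
    also have "\<dots> = x \<bullet> e"
      using fin that by simp
    finally show ?thesis
      by (simp add: inner_diff_left)
  qed
  have "(x - P x) \<bullet> v = 0" if "v \<in> V" for x v
  proof -
    have "v \<in> span E"
      using that E(6) by simp
    then have "orthogonal (x - P x) v"
      by (rule orthogonal_to_span) (simp add: orthogonal_def orth_e)
    then show ?thesis
      by (simp add: orthogonal_def)
  qed
  then show ?thesis
    using lin mem by blast
qed

context
  fixes V :: "'a::euclidean_space set"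
  assumes sub: "subspace V"
begin

lemma linear_orthoproj: "linear (orthoproj V)"
  and orthoproj_mem: "orthoproj V x \<in> V"
  and inner_orthoproj_compl: "v \<in> V \<Longrightarrow> (x - orthoproj V x) \<bullet> v = 0"
  using someI_ex[OF orthoproj_exists[OF sub]] unfolding orthoproj_def by blast+

lemma orthoproj_unique:
  assumes "y \<in> V" and "\<And>v. v \<in> V \<Longrightarrow> (x - y) \<bullet> v = 0"
  shows "orthoproj V x = y"
proof -
  define d where "d = y - orthoproj V x"
  have "d \<in> V"
    unfolding d_def using assms(1) orthoproj_mem sub by (simp add: subspace_diff)
  then have "d \<bullet> d = 0"
    using assms(2) inner_orthoproj_compl[of d x]
    by (simp add: d_def inner_diff_left)
  then show ?thesis
    by (simp add: d_def)
qed

lemma orthoproj_ident: "x \<in> V \<Longrightarrow> orthoproj V x = x"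
  by (rule orthoproj_unique) auto

lemma norm_orthoproj_sq: "(norm (orthoproj V x))\<^sup>2 = orthoproj V x \<bullet> x"
  using inner_orthoproj_compl[OF orthoproj_mem[of x], of x]
  by (simp add: inner_diff_left inner_commute[of x "orthoproj V x"] power2_norm_eq_inner)

lemma orthoproj_pythagoras:
  "(norm x)\<^sup>2 = (norm (orthoproj V x))\<^sup>2 + (norm (x - orthoproj V x))\<^sup>2"
  using inner_orthoproj_compl[OF orthoproj_mem[of x], of x]
  by (simp add: inner_diff_left inner_diff_right inner_commute[of x "orthoproj V x"] power2_norm_eq_inner)

lemma norm_orthoproj_le: "norm (orthoproj V x) \<le> norm x"
  using orthoproj_pythagoras[of x] by (intro power2_le_imp_le[OF _ norm_ge_zero]) simp

lemma norm_orthoproj_compl_le: "norm (x - orthoproj V x) \<le> norm x"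
  using orthoproj_pythagoras[of x] by (intro power2_le_imp_le[OF _ norm_ge_zero]) simp

lemma orthoproj_mem_ball: "x \<in> ball 0 r \<Longrightarrow> orthoproj V x \<in> V \<inter> ball 0 r"
  using orthoproj_mem[of x] norm_orthoproj_le[of x] by (simp add: mem_ball_0)

lemma bounded_linear_orthoproj: "bounded_linear (orthoproj V)"
  using linear_orthoproj linear_conv_bounded_linear by blast

lemmas orthoproj_add = linear_add[OF linear_orthoproj]
  and orthoproj_diff = linear_diff[OF linear_orthoproj]
  and orthoproj_scale = linear_scale[OF linear_orthoproj]
  and orthoproj_0 = linear_0[OF linear_orthoproj]

end

text \<open>Tower property: the residual of the projection to \<open>U\<close> is orthogonal to
  \<open>U\<close>, hence to \<open>T\<close>.\<close>

lemma orthoproj_orthoproj_subset: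
  assumes "subspace T" "subspace U" "T \<subseteq> U"
  shows "orthoproj T (orthoproj U x) = orthoproj T x"
proof (rule orthoproj_unique[OF assms(1)])
  show "orthoproj T x \<in> T"
    by (rule orthoproj_mem[OF assms(1)])
  fix v assume v: "v \<in> T"
  then have "(x - orthoproj U x) \<bullet> v = 0"
    using inner_orthoproj_compl[OF assms(2)] assms(3) by blast
  moreover have "(x - orthoproj T x) \<bullet> v = 0"
    using inner_orthoproj_compl[OF assms(1) v] .
  ultimately show "(orthoproj U x - orthoproj T x) \<bullet> v = 0"
    by (simp add: inner_diff_left)
qed

section \<open>Derivatives of charts\<close>

text \<open>The projection maps the full ball into the slice \<open>V \<inter> ball 0 r\<close>, so
  the chain rule trades a derivative within the slice for one at interior points of an open
  ball.\<close>

lemma differentiable_on_compose_orthoproj: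
  fixes f :: "'a::euclidean_space \<Rightarrow> 'b::euclidean_space"
  assumes V: "subspace V" and f: "f differentiable_on (V \<inter> ball 0 r)" and x: "x \<in> ball 0 r"
  shows "((\<lambda>x. f (orthoproj V x)) has_derivative
           (\<lambda>h. frechet_derivative f (at (orthoproj V x) within V \<inter> ball 0 r) (orthoproj V h))) (at x)"
proof -
  have img: "orthoproj V ` ball 0 r \<subseteq> V \<inter> ball 0 r"
    using orthoproj_mem_ball[OF V] by blast
  have d1: "(orthoproj V has_derivative orthoproj V) (at x within ball 0 r)"
    by (rule bounded_linear_imp_has_derivative[OF bounded_linear_orthoproj[OF V]])
  have "(f has_derivative frechet_derivative f (at (orthoproj V x) within V \<inter> ball 0 r))
      (at (orthoproj V x) within V \<inter> ball 0 r)"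
    unfolding frechet_derivative_works[symmetric]
    using f orthoproj_mem_ball[OF V x] unfolding differentiable_on_def by (rule bspec)
  then have "(f has_derivative frechet_derivative f (at (orthoproj V x) within V \<inter> ball 0 r))
      (at (orthoproj V x) within orthoproj V ` ball 0 r)"
    by (rule has_derivative_subset[OF _ img])
  from has_derivative_in_compose[OF d1 this] show ?thesis
    by (simp only: at_within_open[OF x open_ball])
qed

text \<open>On the smaller closed ball compactness bounds each \<open>H x h\<close> with
  \<open>h\<close> a basis vector. The sum of these bounds dominates the operator norm, and the mean
  value inequality applies on the convex ball.\<close>

lemma continuous_derivative_imp_lipschitz_cball:
  fixes g :: "'a::euclidean_space \<Rightarrow> 'b::euclidean_space"
  assumes der: "\<And>x. x \<in> ball 0 r \<Longrightarrow> (g has_derivative H x) (at x)"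
    and cont: "\<And>h. h \<in> Basis \<Longrightarrow> continuous_on (ball 0 r) (\<lambda>x. H x h)"
    and "\<rho> < r"
  shows "\<exists>C\<ge>0. \<forall>x\<in>cball 0 \<rho>. \<forall>y\<in>cball 0 \<rho>. norm (g x - g y) \<le> C * norm (x - y)"
proof -
  have sub: "cball 0 \<rho> \<subseteq> ball (0::'a) r"
    using assms(3) by auto
  have "\<exists>K\<ge>0. \<forall>x\<in>cball 0 \<rho>. norm (H x h) \<le> K" if "h \<in> Basis" for h
  proof -
    have "compact ((\<lambda>x. H x h) ` cball 0 \<rho>)"
      by (rule compact_continuous_image[OF continuous_on_subset[OF cont[OF that] sub] compact_cball])
    then have "bounded ((\<lambda>x. H x h) ` cball 0 \<rho>)"
      by (rule compact_imp_bounded)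
    then obtain K where "K > 0" "\<And>y. y \<in> (\<lambda>x. H x h) ` cball 0 \<rho> \<Longrightarrow> norm y \<le> K"
      unfolding bounded_pos by blast
    then show ?thesis
      by (intro exI[of _ K]) auto
  qed
  then obtain K where K: "\<And>h. h \<in> Basis \<Longrightarrow> 0 \<le> K h \<and> (\<forall>x\<in>cball 0 \<rho>. norm (H x h) \<le> K h)"
    by metis
  define C where "C = (\<Sum>h\<in>Basis. K h)"
  have "norm (g x - g y) \<le> C * norm (x - y)" if "x \<in> cball 0 \<rho>" "y \<in> cball 0 \<rho>" for x y
  proof (rule differentiable_bound[OF convex_cball])
    show "(g has_derivative H x) (at x within cball 0 \<rho>)" if "x \<in> cball 0 \<rho>" for x
      using der sub that has_derivative_at_withinI by blast
    show "onorm (H x) \<le> C" if "x \<in> cball 0 \<rho>" for x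
    proof -
      have bl: "bounded_linear (H x)"
        using der sub that has_derivative_bounded_linear by blast
      have "onorm (H x) \<le> (\<Sum>h\<in>Basis. norm (H x h))"
        by (rule onorm_componentwise[OF bl])
      also have "\<dots> \<le> C"
        unfolding C_def using K that by (intro sum_mono) auto
      finally show ?thesis .
    qed
  qed (use that in auto)
  moreover have "C \<ge> 0"
    unfolding C_def using K by (auto intro: sum_nonneg)
  ultimately show ?thesis
    by blast
qed

text \<open>The derivative is computed after composing the chart with the projection onto the parameter
  space, since within \<open>V\<close> it is only determined on \<open>V\<close>.\<close>

lemma C2_derivative_lipschitz:
  fixes \<phi> :: "'a::euclidean_space \<Rightarrow> 'b::euclidean_space"
  assumes V: "subspace V" and C2: "Ck_on 2 V (V \<inter> ball 0 r) \<phi>" and "r > 0"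
  obtains G C where
    "\<And>x. x \<in> ball 0 r \<Longrightarrow> ((\<lambda>x. \<phi> (orthoproj V x)) has_derivative G x) (at x)"
    "\<And>x y v. x \<in> cball 0 (r/2) \<Longrightarrow> y \<in> cball 0 (r/2) \<Longrightarrow>
       norm (G x v - G y v) \<le> C * norm (x - y) * norm v"
    "C \<ge> 0"
    "\<And>v. v \<in> V \<Longrightarrow> G 0 v = frechet_derivative \<phi> (at 0 within V \<inter> ball 0 r) v"
proof -
  define S where "S = V \<inter> ball 0 r"
  define P where "P = orthoproj V"
  define D where "D x = frechet_derivative \<phi> (at x within S)" for x
  define G where "G = (\<lambda>x v. D (P x) (P v))"
  have PS: "P x \<in> S" if "x \<in> ball 0 r" for x
    unfolding P_def S_def by (rule orthoproj_mem_ball[OF V that])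
  have C2': "\<phi> differentiable_on S"
    "\<And>v. v \<in> V \<Longrightarrow> (\<lambda>x. D x v) differentiable_on S"
    "\<And>v w. v \<in> V \<Longrightarrow> w \<in> V \<Longrightarrow>
       continuous_on S (\<lambda>x. frechet_derivative (\<lambda>x. D x v) (at x within S) w)"
    using C2 unfolding numeral_2_eq_2 Ck_on.simps S_def[symmetric] D_def[symmetric] by blast+
  have der: "((\<lambda>x. \<phi> (orthoproj V x)) has_derivative G x) (at x)" if "x \<in> ball 0 r" for x
    using differentiable_on_compose_orthoproj[OF V C2'(1)[unfolded S_def] that]
    by (simp add: G_def D_def P_def S_def)
  \<comment> \<open>For one fixed direction \<open>v\<close> the continuous second derivatives give
    a Lipschitz constant, which may depend on \<open>v\<close>.\<close>
  have "\<exists>C\<ge>0. \<forall>x\<in>cball 0 (r/2). \<forall>y\<in>cball 0 (r/2). norm (G x v - G y v) \<le> C * norm (x - y)" for v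
    unfolding G_def
  proof (rule continuous_derivative_imp_lipschitz_cball)
    have Pv: "P v \<in> V" for v
      by (simp add: P_def orthoproj_mem[OF V])
    let ?H = "\<lambda>x h. frechet_derivative (\<lambda>x. D x (P v)) (at (P x) within S) (P h)"
    show "((\<lambda>x. D (P x) (P v)) has_derivative ?H x) (at x)" if "x \<in> ball 0 r" for x
      using differentiable_on_compose_orthoproj[OF V C2'(2)[OF Pv, unfolded S_def] that]
      by (simp add: P_def S_def)
    show "continuous_on (ball 0 r) (\<lambda>x. ?H x h)" for h
    proof (rule continuous_on_compose2[OF C2'(3)[OF Pv Pv]])
      show "continuous_on (ball 0 r) P"
        unfolding P_def by (intro linear_continuous_on bounded_linear_orthoproj V)
    qed (use PS in auto)
  qed (use assms in simp)
  then obtain C where C: "\<And>v. C v \<ge> 0"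
    "\<And>v x y. x\<in>cball 0 (r/2) \<Longrightarrow> y\<in>cball 0 (r/2) \<Longrightarrow> norm (G x v - G y v) \<le> C v * norm (x - y)"
    by metis
  \<comment> \<open>Expanding an arbitrary direction in the basis makes the constant uniform:
    finitely many constants are added up, and each coordinate of \<open>v\<close> is at most
    \<open>norm v\<close>.\<close>
  define K where "K = (\<Sum>b\<in>Basis. C b)"
  have "norm (G x v - G y v) \<le> K * norm (x - y) * norm v"
    if xy: "x \<in> cball 0 (r/2)" "y \<in> cball 0 (r/2)" for x y v
  proof -
    have "x \<in> ball 0 r" "y \<in> ball 0 r"
      using xy assms(3) by auto
    then have "linear (G x)" "linear (G y)"
      using der has_derivative_linear by blast+
    then have lin: "linear (\<lambda>v. G x v - G y v)"
      by (rule linear_compose_sub)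
    have "norm (G x v - G y v) = norm (\<Sum>b\<in>Basis. (v \<bullet> b) *\<^sub>R (G x b - G y b))"
      using linear_sum[OF lin, of "\<lambda>b. (v \<bullet> b) *\<^sub>R b" Basis]
      by (simp add: euclidean_representation linear_scale[OF lin])
    also have "\<dots> \<le> (\<Sum>b\<in>Basis. norm v * (C b * norm (x - y)))"
    proof (rule sum_norm_le)
      fix b :: 'a assume "b \<in> Basis"
      then have "\<bar>v \<bullet> b\<bar> \<le> norm v"
        by (rule Basis_le_norm)
      then show "norm ((v \<bullet> b) *\<^sub>R (G x b - G y b)) \<le> norm v * (C b * norm (x - y))"
        using C(2)[OF xy, of b] by (simp add: mult_mono)
    qed
    also have "\<dots> = K * norm (x - y) * norm v"
      unfolding K_def by (simp add: sum_distrib_left sum_distrib_right mult_ac)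
    finally show ?thesis .
  qed
  moreover have "K \<ge> 0"
    unfolding K_def by (intro sum_nonneg C(1))
  moreover have "G 0 v = frechet_derivative \<phi> (at 0 within V \<inter> ball 0 r) v" if "v \<in> V" for v
    using that by (simp add: G_def D_def P_def S_def orthoproj_ident[OF V] orthoproj_0[OF V])
  ultimately show thesis
    using that der by blast
qed

text \<open>The mean value inequality on the segment from \<open>x\<close> to \<open>y\<close> is
  applied to \<open>F\<close> minus the linear map \<open>G x\<close>, whose derivative
  \<open>G z - G x\<close> has norm at most \<open>C * norm (y - x)\<close> there.\<close>

lemma lipschitz_derivative_taylor:
  fixes F :: "'a::euclidean_space \<Rightarrow> 'b::euclidean_space"
  assumes der: "\<And>x. x \<in> cball 0 \<rho> \<Longrightarrow> (F has_derivative G x) (at x)"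
    and lip: "\<And>x y v. x \<in> cball 0 \<rho> \<Longrightarrow> y \<in> cball 0 \<rho> \<Longrightarrow>
       norm (G x v - G y v) \<le> C * norm (x - y) * norm v"
    and "C \<ge> 0" and x: "x \<in> cball 0 \<rho>" and y: "y \<in> cball 0 \<rho>"
  shows "norm (F y - F x - G x (y - x)) \<le> C * (norm (y - x))\<^sup>2"
proof -
  define S where "S = closed_segment x y"
  have S: "S \<subseteq> cball 0 \<rho>"
    unfolding S_def using x y convex_cball closed_segment_subset by blast
  have lin: "linear (G x)"
    using der[OF x] has_derivative_linear by blast
  have "norm ((F y - G x y) - (F x - G x x)) \<le> (C * norm (y - x)) * norm (y - x)"
  proof (rule differentiable_bound)
    show "convex S"
      by (simp add: S_def)
    show "((\<lambda>z. F z - G x z) has_derivative (\<lambda>v. G z v - G x v)) (at z within S)" if "z \<in> S" for z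
    proof (intro has_derivative_diff)
      show "(F has_derivative G z) (at z within S)"
        using der S that has_derivative_at_withinI by blast
      show "(G x has_derivative G x) (at z within S)"
        using lin by (simp add: bounded_linear_imp_has_derivative linear_conv_bounded_linear)
    qed
    show "onorm (\<lambda>v. G z v - G x v) \<le> C * norm (y - x)" if "z \<in> S" for z
    proof (rule onorm_bound)
      fix v
      have "norm (G z v - G x v) \<le> C * norm (z - x) * norm v"
        using lip S that x by blast
      also have "\<dots> \<le> C * norm (y - x) * norm v"
        using segment_bound(1)[of z x y] that \<open>C \<ge> 0\<close>
        by (intro mult_right_mono mult_left_mono) (auto simp: S_def)
      finally show "norm (G z v - G x v) \<le> C * norm (y - x) * norm v" .
    qed (use \<open>C \<ge> 0\<close> in simp)
  qed (auto simp: S_def)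
  then show ?thesis
    by (simp add: linear_diff[OF lin] power2_eq_square algebra_simps)
qed

text \<open>\<open>D\<close> stands for the derivative of the chart at the origin. The first error
  bound is strict differentiability at the origin with a linear rate. The second makes the chart
  affine at midpoints up to second order, which is what uniqueness of nearest points uses. The last
  clause is continuity of the inverse chart at \<open>A\<close>, together with the fact that the
  chart covers \<open>M\<close> near \<open>A\<close>.\<close>

definition chart_estimates ::
  "'a::euclidean_space set \<Rightarrow> 'a set \<Rightarrow> 'a \<Rightarrow> 'a set \<Rightarrow> ('a \<Rightarrow> 'a) \<Rightarrow> ('a \<Rightarrow> 'a) \<Rightarrow> real \<Rightarrow> real \<Rightarrow> real \<Rightarrow> bool"
  where
  "chart_estimates M T A V \<phi> D c C r \<longleftrightarrow>
     subspace V \<and> linear D \<and> D ` V = T \<and> c > 0 \<and> (\<forall>v\<in>V. c * norm v \<le> norm (D v)) \<and>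
     C \<ge> 0 \<and> r > 0 \<and> \<phi> 0 = A \<and>
     (\<forall>x\<in>V \<inter> cball 0 r. \<forall>y\<in>V \<inter> cball 0 r.
        norm (\<phi> y - \<phi> x - D (y - x)) \<le> C * (norm x + norm y) * norm (y - x)) \<and>
     (\<forall>x\<in>V \<inter> cball 0 r. \<forall>y\<in>V \<inter> cball 0 r.
        norm (midpoint (\<phi> x) (\<phi> y) - \<phi> (midpoint x y)) \<le> C * (norm (y - x))\<^sup>2) \<and>
     \<phi> ` (V \<inter> ball 0 r) \<subseteq> M \<and>
     (\<forall>\<rho>>0. \<exists>\<eta>>0. M \<inter> ball A \<eta> \<subseteq> \<phi> ` (V \<inter> ball 0 \<rho>))"

text \<open>Everything follows from the second-order Taylor bound for the chart composed with the
  projection to \<open>V\<close>. The radius is halved because the Lipschitz bound on the derivative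
  is available on \<open>cball 0 (r/2)\<close>.\<close>

lemma local_chart_imp_chart_estimates:
  fixes M :: "'a::euclidean_space set"
  assumes chart: "local_chart 2 m M A V r \<phi>"
    and T: "T = frechet_derivative \<phi> (at 0 within V \<inter> ball 0 r) ` V"
  obtains D c C \<rho> where "chart_estimates M T A V \<phi> D c C \<rho>"
proof -
  define S where "S = V \<inter> ball 0 r"
  have V: "subspace V" and r: "r > 0" and C2: "Ck_on 2 V (V \<inter> ball 0 r) \<phi>"
    and inj: "\<And>x. x \<in> S \<Longrightarrow> inj_on (frechet_derivative \<phi> (at x within S)) V"
    and \<phi>0: "\<phi> 0 = A" and op: "openin (top_of_set M) (\<phi> ` S)"
    and homeo: "\<exists>\<psi>. homeomorphism S (\<phi> ` S) \<phi> \<psi>"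
    using chart by (auto simp: local_chart_def Let_def S_def)
  obtain G C where G:
    "\<And>x. x \<in> ball 0 r \<Longrightarrow> ((\<lambda>x. \<phi> (orthoproj V x)) has_derivative G x) (at x)"
    "\<And>x y v. x \<in> cball 0 (r/2) \<Longrightarrow> y \<in> cball 0 (r/2) \<Longrightarrow>
       norm (G x v - G y v) \<le> C * norm (x - y) * norm v"
    "C \<ge> 0"
    "\<And>v. v \<in> V \<Longrightarrow> G 0 v = frechet_derivative \<phi> (at 0 within V \<inter> ball 0 r) v"
    using C2_derivative_lipschitz[OF V C2 r] by metis
  have sub: "cball 0 (r/2) \<subseteq> ball (0::'a) r"
    using r by auto
  have taylor: "norm (\<phi> y - \<phi> x - G x (y - x)) \<le> C * (norm (y - x))\<^sup>2"
    if "x \<in> V \<inter> cball 0 (r/2)" "y \<in> V \<inter> cball 0 (r/2)" for x y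
    using lipschitz_derivative_taylor[of "r/2" "\<lambda>x. \<phi> (orthoproj V x)" G C x y] G(1,2,3) sub that
    by (auto simp: orthoproj_ident[OF V] subset_iff)
  have lin: "linear (G x)" if "x \<in> ball 0 r" for x
    using G(1)[OF that] has_derivative_linear by blast
  have lin0: "linear (G 0)"
    using lin r by simp
  have 0: "0 \<in> S"
    using V r subspace_0 by (auto simp: S_def)
  have injG: "inj_on (G 0) V"
    using inj[OF 0] G(4) by (simp add: inj_on_def S_def)
  \<comment> \<open>An injective linear map has a linear left inverse; a bound \<open>K\<close> for
    it yields the lower bound \<open>1/K\<close> for the derivative.\<close>
  obtain E where E: "linear E" "\<And>v. v \<in> V \<Longrightarrow> E (G 0 v) = v"
    using linear_exists_left_inverse_on[OF lin0 V injG] by blast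
  obtain K where K: "K > 0" "\<And>x. norm (E x) \<le> K * norm x"
    using linear_bounded_pos[OF E(1)] by (metis mult.commute)
  have below: "(1/K) * norm v \<le> norm (G 0 v)" if "v \<in> V" for v
    using K(2)[of "G 0 v"] E(2)[OF that] K(1) by (simp add: field_simps)
  \<comment> \<open>Taylor expansion at \<open>x\<close>, followed by replacing \<open>G x\<close>
    with \<open>G 0\<close> at cost \<open>C * norm x\<close>. The factor 2 comes from
    \<open>norm (y - x) + norm x \<le> 2 * (norm x + norm y)\<close>.\<close>
  have strict: "norm (\<phi> y - \<phi> x - G 0 (y - x)) \<le> (2*C) * (norm x + norm y) * norm (y - x)"
    if xy: "x \<in> V \<inter> cball 0 (r/2)" "y \<in> V \<inter> cball 0 (r/2)" for x y
  proof -
    have a: "norm (\<phi> y - \<phi> x - G x (y - x)) \<le> C * (norm (y - x))\<^sup>2"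
      by (rule taylor[OF xy])
    have b: "norm (G x (y - x) - G 0 (y - x)) \<le> C * norm x * norm (y - x)"
      using G(2)[of x 0 "y - x"] xy r by simp
    have "norm (\<phi> y - \<phi> x - G 0 (y - x)) \<le> C * (norm (y - x))\<^sup>2 + C * norm x * norm (y - x)"
      using norm_triangle_mono[OF a b] by simp
    also have "\<dots> = C * (norm (y - x) + norm x) * norm (y - x)"
      by (simp add: power2_eq_square algebra_simps)
    also have "\<dots> \<le> C * (2 * (norm x + norm y)) * norm (y - x)"
    proof (intro mult_right_mono mult_left_mono)
      show "norm (y - x) + norm x \<le> 2 * (norm x + norm y)"
        using norm_triangle_ineq4[of y x] norm_ge_zero[of y] by argo
    qed (use G(3) in auto)
    finally show ?thesis
      by (simp add: mult_ac)
  qed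
  have mid: "norm (midpoint (\<phi> x) (\<phi> y) - \<phi> (midpoint x y)) \<le> (2*C) * (norm (y - x))\<^sup>2"
    if xy: "x \<in> V \<inter> cball 0 (r/2)" "y \<in> V \<inter> cball 0 (r/2)" for x y
  proof -
    let ?m = "midpoint x y"
    have m: "?m \<in> V \<inter> cball 0 (r/2)"
    proof -
      have "closed_segment x y \<subseteq> V \<inter> cball 0 (r/2)"
        by (intro closed_segment_subset xy convex_Int convex_cball subspace_imp_convex[OF V])
      then show ?thesis
        using midpoint_in_closed_segment by blast
    qed
    let ?u = "\<phi> x - \<phi> ?m - G ?m (x - ?m)" and ?w = "\<phi> y - \<phi> ?m - G ?m (y - ?m)"
    have linm: "linear (G ?m)"
      using lin m sub by blast
    \<comment> \<open>The endpoints are symmetric about the point of expansion, so the linear Taylor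
      terms are opposite and cancel when the two remainders are added.\<close>
    have eq: "y - ?m = - (x - ?m)"
      using midpoint_plus_self[of x y] by (simp add: algebra_simps)
    have n1: "norm (x - ?m) = norm (y - x) / 2"
      using dist_midpoint(1)[of x y] by (simp add: dist_norm norm_minus_commute[of y x])
    have n: "norm (x - ?m) = norm (y - x) / 2" "norm (y - ?m) = norm (y - x) / 2"
      unfolding eq norm_minus_cancel by (rule n1)+
    have "?u + ?w = 2 *\<^sub>R (midpoint (\<phi> x) (\<phi> y) - \<phi> ?m)"
    proof -
      have "2 *\<^sub>R midpoint (\<phi> x) (\<phi> y) = \<phi> x + \<phi> y"
        by (simp add: midpoint_def)
      moreover have "2 *\<^sub>R \<phi> ?m = \<phi> ?m + \<phi> ?m"
        by (rule scaleR_2)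
      ultimately show ?thesis
        unfolding eq linear_neg[OF linm] scaleR_diff_right by (simp add: algebra_simps)
    qed
    then have "2 * norm (midpoint (\<phi> x) (\<phi> y) - \<phi> ?m) = norm (?u + ?w)"
      by simp
    also have "\<dots> \<le> C * (norm (y - x) / 2)\<^sup>2 + C * (norm (y - x) / 2)\<^sup>2"
      using taylor[OF m xy(1)] taylor[OF m xy(2)] unfolding n by (rule norm_triangle_mono)
    also have "\<dots> \<le> 2 * ((2*C) * (norm (y - x))\<^sup>2)"
      using G(3) by (simp add: power_divide mult_left_mono)
    finally show ?thesis
      by simp
  qed
  \<comment> \<open>The homeomorphism maps the smaller slice to a set open in the chart image, hence
    open in \<open>M\<close>; it contains \<open>A\<close>, so it contains a ball of
    \<open>M\<close> about \<open>A\<close>.\<close>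
  have "\<exists>\<eta>>0. M \<inter> ball A \<eta> \<subseteq> \<phi> ` (V \<inter> ball 0 \<rho>)" if "\<rho> > 0" for \<rho>
  proof -
    obtain \<psi> where "homeomorphism S (\<phi> ` S) \<phi> \<psi>"
      using homeo by blast
    moreover have "openin (top_of_set S) (S \<inter> ball 0 \<rho>)"
      by (simp add: openin_open_Int)
    ultimately have "openin (top_of_set (\<phi> ` S)) (\<phi> ` (S \<inter> ball 0 \<rho>))"
      by (rule homeomorphism_imp_open_map)
    then have "openin (top_of_set M) (\<phi> ` (S \<inter> ball 0 \<rho>))"
      using op openin_trans by blast
    moreover have "A \<in> \<phi> ` (S \<inter> ball 0 \<rho>)"
      using \<phi>0 0 that by force
    ultimately obtain \<eta> where "\<eta> > 0" "ball A \<eta> \<inter> M \<subseteq> \<phi> ` (S \<inter> ball 0 \<rho>)"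
      using openin_contains_ball by metis
    then show ?thesis
      by (intro exI[of _ \<eta>]) (auto simp: S_def)
  qed
  moreover have "\<phi> ` (V \<inter> ball 0 (r/2)) \<subseteq> M"
  proof -
    have "\<phi> ` (V \<inter> ball 0 (r/2)) \<subseteq> \<phi> ` S"
      using r by (auto simp: S_def)
    also have "\<dots> \<subseteq> M"
      using op openin_imp_subset by blast
    finally show ?thesis .
  qed
  moreover have "G 0 ` V = T"
    unfolding T using G(4) by auto
  ultimately have "chart_estimates M T A V \<phi> (G 0) (1/K) (2*C) (r/2)"
    using V lin0 K(1) below strict mid G(3) r \<phi>0 by (simp add: chart_estimates_def)
  then show thesis
    by (rule that)
qed

section \<open>Secants and nearest points\<close>

text \<open>A relation instead of a function, so that nearest points can be compared before their
  uniqueness is known.\<close>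

definition nearest :: "'a::metric_space set \<Rightarrow> 'a \<Rightarrow> 'a \<Rightarrow> bool" where
  "nearest M B p \<longleftrightarrow> p \<in> M \<and> (\<forall>y\<in>M. dist B p \<le> dist B y)"

lemma nearest_near:
  assumes "nearest M B p" "A \<in> M"
  shows "dist B p \<le> dist B A" and "dist A p \<le> 2 * dist B A"
proof -
  show "dist B p \<le> dist B A"
    using assms by (auto simp: nearest_def)
  then show "dist A p \<le> 2 * dist B A"
    using dist_triangle[of A p B] by (simp add: dist_commute)
qed

context
  fixes M T V :: "'a::euclidean_space set" and A :: 'a and \<phi> D :: "'a \<Rightarrow> 'a" and c C r :: real
  assumes ce: "chart_estimates M T A V \<phi> D c C r"
begin

lemma
  shows param_subspace: "subspace V" and linear_deriv: "linear D" and deriv_image: "D ` V = T" and lower_bound_pos: "c > 0"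
    and deriv_below: "v \<in> V \<Longrightarrow> c * norm v \<le> norm (D v)"
    and error_nonneg: "C \<ge> 0" and radius_pos: "r > 0" and chart_center: "\<phi> 0 = A"
    and strict_estimate: "x \<in> V \<inter> cball 0 r \<Longrightarrow> y \<in> V \<inter> cball 0 r \<Longrightarrow>
        norm (\<phi> y - \<phi> x - D (y - x)) \<le> C * (norm x + norm y) * norm (y - x)"
    and midpoint_estimate: "x \<in> V \<inter> cball 0 r \<Longrightarrow> y \<in> V \<inter> cball 0 r \<Longrightarrow>
        norm (midpoint (\<phi> x) (\<phi> y) - \<phi> (midpoint x y)) \<le> C * (norm (y - x))\<^sup>2"
    and chart_into: "x \<in> V \<Longrightarrow> norm x < r \<Longrightarrow> \<phi> x \<in> M"
    and chart_onto: "\<rho> > 0 \<Longrightarrow> \<exists>\<eta>>0. M \<inter> ball A \<eta> \<subseteq> \<phi> ` (V \<inter> ball 0 \<rho>)"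
  using ce unfolding chart_estimates_def by (simp_all add: image_subset_iff)

lemma subspace_chart_tangent: "subspace T"
  using linear_subspace_image[OF linear_deriv param_subspace] by (simp add: deriv_image)

lemma chart_center_mem: "A \<in> M"
  using chart_into[of 0] subspace_0[OF param_subspace] radius_pos chart_center by simp

lemma chart_strict:
  assumes "\<kappa> > 0"
  obtains \<rho> where "0 < \<rho>" "\<rho> < r" "\<And>x y. x \<in> V \<inter> cball 0 \<rho> \<Longrightarrow> y \<in> V \<inter> cball 0 \<rho> \<Longrightarrow>
      norm (\<phi> y - \<phi> x - D (y - x)) \<le> \<kappa> * norm (y - x)"
proof
  \<comment> \<open>With both points of norm at most \<open>\<rho>\<close> the factor
    \<open>C * (norm x + norm y)\<close> drops to at most \<open>\<kappa>\<close>. Using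
    \<open>C + 1\<close> avoids dividing by zero.\<close>
  define \<rho> where "\<rho> = min (r/2) (\<kappa> / (2 * (C + 1)))"
  show "0 < \<rho>" "\<rho> < r"
    using radius_pos assms error_nonneg by (auto simp: \<rho>_def)
  fix x y assume xy: "x \<in> V \<inter> cball 0 \<rho>" "y \<in> V \<inter> cball 0 \<rho>"
  have "\<rho> \<le> \<kappa> / (2 * (C + 1))"
    by (simp add: \<rho>_def)
  then have "2 * (C + 1) * \<rho> \<le> \<kappa>"
    using error_nonneg by (simp add: field_simps)
  moreover have "C * (norm x + norm y) \<le> (C + 1) * (2 * \<rho>)"
    using xy error_nonneg by (intro mult_mono) auto
  ultimately have *: "C * (norm x + norm y) \<le> \<kappa>"
    by (simp add: algebra_simps)
  have "norm (\<phi> y - \<phi> x - D (y - x)) \<le> C * (norm x + norm y) * norm (y - x)"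
    using strict_estimate xy \<open>\<rho> < r\<close> by simp
  also have "\<dots> \<le> \<kappa> * norm (y - x)"
    by (intro mult_right_mono *) simp
  finally show "norm (\<phi> y - \<phi> x - D (y - x)) \<le> \<kappa> * norm (y - x)" .
qed

text \<open>The derivative expands by at least \<open>c\<close>, and the error eats up at most half
  of this.\<close>

lemma chart_below:
  assumes "norm (\<phi> y - \<phi> x - D (y - x)) \<le> \<kappa> * norm (y - x)" "\<kappa> \<le> c/2" "x \<in> V" "y \<in> V"
  shows "c/2 * norm (y - x) \<le> norm (\<phi> y - \<phi> x)"
proof -
  have "c * norm (y - x) \<le> norm (D (y - x))"
    using deriv_below subspace_diff[OF param_subspace] assms by simp
  also have "\<dots> \<le> norm (\<phi> y - \<phi> x) + norm (\<phi> y - \<phi> x - D (y - x))"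
    using norm_triangle_ineq4[of "\<phi> y - \<phi> x" "\<phi> y - \<phi> x - D (y - x)"] by simp
  also have "\<dots> \<le> norm (\<phi> y - \<phi> x) + c/2 * norm (y - x)"
    using order_trans[OF assms(1) mult_right_mono[OF assms(2) norm_ge_zero]] by simp
  finally show ?thesis
    by (simp add: algebra_simps)
qed

text \<open>The linear part \<open>D (v - u)\<close> of a secant lies in \<open>T\<close>, so only
  the strict-differentiability error contributes to the residual; \<open>chart_below\<close>
  expresses it by the length of the secant.\<close>

lemma chart_secants:
  assumes "\<delta> > 0"
  shows "\<exists>\<eta>>0. \<forall>x\<in>M \<inter> ball A \<eta>. \<forall>y\<in>M \<inter> ball A \<eta>.
           norm ((y - x) - orthoproj T (y - x)) \<le> \<delta> * norm (y - x)"
proof -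
  note T = subspace_chart_tangent
  \<comment> \<open>The first entry makes \<open>chart_below\<close> applicable; the second pays for
    the factor \<open>c/2\<close> lost in passing from parameters to points.\<close>
  define \<kappa> where "\<kappa> = min (c/2) (\<delta> * c/2)"
  have \<kappa>: "\<kappa> > 0" "\<kappa> \<le> c/2" "\<kappa> \<le> \<delta> * (c/2)"
    using lower_bound_pos assms by (auto simp: \<kappa>_def)
  obtain \<rho> where \<rho>: "0 < \<rho>" "\<rho> < r" and st: "\<And>x y. x \<in> V \<inter> cball 0 \<rho> \<Longrightarrow> y \<in> V \<inter> cball 0 \<rho> \<Longrightarrow>
      norm (\<phi> y - \<phi> x - D (y - x)) \<le> \<kappa> * norm (y - x)"
    using chart_strict[OF \<kappa>(1)] by blast
  obtain \<eta> where \<eta>: "\<eta> > 0" "M \<inter> ball A \<eta> \<subseteq> \<phi> ` (V \<inter> ball 0 \<rho>)"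
    using chart_onto[OF \<rho>(1)] by blast
  have "norm ((y - x) - orthoproj T (y - x)) \<le> \<delta> * norm (y - x)"
    if xy: "x \<in> M \<inter> ball A \<eta>" "y \<in> M \<inter> ball A \<eta>" for x y
  proof -
    obtain u v where u: "x = \<phi> u" "u \<in> V" "u \<in> cball 0 \<rho>" and v: "y = \<phi> v" "v \<in> V" "v \<in> cball 0 \<rho>"
      using \<eta>(2) xy ball_subset_cball[of "0::'a" \<rho>] by blast
    define e where "e = y - x - D (v - u)"
    have e: "norm e \<le> \<kappa> * norm (v - u)"
      using st[of u v] u v by (simp add: e_def)
    have "orthoproj T (D (v - u)) = D (v - u)"
      by (rule orthoproj_ident[OF T]) (use deriv_image subspace_diff[OF param_subspace v(2) u(2)] in blast)
    then have "(y - x) - orthoproj T (y - x) = e - orthoproj T e"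
      by (simp add: e_def orthoproj_diff[OF T])
    then have "norm ((y - x) - orthoproj T (y - x)) \<le> norm e"
      using norm_orthoproj_compl_le[OF T] by simp
    also have "\<dots> \<le> \<delta> * (c/2) * norm (v - u)"
      by (rule order_trans[OF e mult_right_mono[OF \<kappa>(3)]]) simp
    also have "\<dots> = \<delta> * (c/2 * norm (v - u))"
      by simp
    also have "\<dots> \<le> \<delta> * norm (y - x)"
      using chart_below[OF e[unfolded e_def u v] \<kappa>(2) u(2) v(2)] assms u v by simp
    finally show ?thesis .
  qed
  then show ?thesis
    using \<eta>(1) by blast
qed

text \<open>First-order optimality with the derivative frozen at the centre: \<open>p\<close> is
  moved along the chart in a direction \<open>v\<close> whose image under \<open>D\<close> is the
  tangential part of \<open>n = B - p\<close>. Minimality gives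
  \<open>2 * (n \<bullet> d) \<le> (norm d)\<^sup>2\<close>, where \<open>d\<close> is the
  displacement, and this right-hand side is quadratic in the step size.\<close>

lemma chart_normals:
  assumes "\<delta> > 0"
  shows "\<exists>\<eta>>0. \<forall>B\<in>ball A \<eta>. \<forall>p. nearest M B p \<longrightarrow> norm (orthoproj T (B - p)) \<le> \<delta> * norm (B - p)"
proof -
  note T = subspace_chart_tangent
  define \<kappa> where "\<kappa> = \<delta> * c"
  have \<kappa>: "\<kappa> > 0"
    using lower_bound_pos assms by (simp add: \<kappa>_def)
  obtain \<rho> where \<rho>: "0 < \<rho>" "\<rho> < r" and st: "\<And>x y. x \<in> V \<inter> cball 0 \<rho> \<Longrightarrow> y \<in> V \<inter> cball 0 \<rho> \<Longrightarrow>
      norm (\<phi> y - \<phi> x - D (y - x)) \<le> \<kappa> * norm (y - x)"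
    using chart_strict[OF \<kappa>] by blast
  obtain \<eta> where \<eta>: "\<eta> > 0" "M \<inter> ball A \<eta> \<subseteq> \<phi> ` (V \<inter> ball 0 \<rho>)"
    using chart_onto[OF \<rho>(1)] by blast
  \<comment> \<open>A nearest point is at most twice as far from \<open>A\<close> as
    \<open>B\<close> is; the halved radius therefore keeps \<open>p\<close> in the part of
    \<open>M\<close> covered by the chart.\<close>
  have "norm (orthoproj T (B - p)) \<le> \<delta> * norm (B - p)"
    if B: "B \<in> ball A (\<eta>/2)" and p: "nearest M B p" for B p
  proof -
    have "dist A p < \<eta>"
      using nearest_near(2)[OF p chart_center_mem] B by (simp add: dist_commute)
    then obtain u where u: "p = \<phi> u" "u \<in> V" "norm u < \<rho>"
      using \<eta>(2) p by (auto simp: nearest_def)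
    define n where "n = B - p"
    have "orthoproj T n \<in> D ` V"
      unfolding deriv_image by (rule orthoproj_mem[OF T])
    then obtain v where v: "v \<in> V" "D v = orthoproj T n"
      by auto
    define K where "K = (norm (D v) + \<kappa> * norm v)\<^sup>2"
    \<comment> \<open>Steps below this bound keep \<open>u + \<tau> v\<close> inside the ball of
      radius \<open>\<rho>\<close>. The summand 1 covers \<open>v = 0\<close>.\<close>
    define \<tau>0 where "\<tau>0 = (\<rho> - norm u) / (norm v + 1)"
    have nv: "norm v + 1 > 0"
      by (simp add: add_nonneg_pos)
    have \<tau>0: "\<tau>0 > 0"
      using u(3) nv by (simp add: \<tau>0_def)
    have main: "2 * (n \<bullet> D v) \<le> 2 * (norm n * (\<kappa> * norm v)) + \<tau> * K" if \<tau>: "0 < \<tau>" "\<tau> < \<tau>0" for \<tau>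
    proof -
      define w where "w = u + \<tau> *\<^sub>R v"
      have "\<tau> * norm v \<le> \<tau> * (norm v + 1)"
        using \<tau> by simp
      also have "\<dots> < \<rho> - norm u"
        using \<tau>(2) nv by (simp add: \<tau>0_def field_simps)
      finally have "norm w < \<rho>"
        using norm_triangle_ineq[of u "\<tau> *\<^sub>R v"] \<tau> by (simp add: w_def)
      have w: "w \<in> V"
        unfolding w_def by (intro subspace_add subspace_scale param_subspace u v)
      have y: "\<phi> w \<in> M"
        using chart_into[OF w] \<open>norm w < \<rho>\<close> \<rho>(2) by simp
      define d where "d = \<phi> w - p"
      define e where "e = d - \<tau> *\<^sub>R D v"
      have e: "norm e \<le> \<kappa> * (\<tau> * norm v)"
        using st[of u w] u w \<open>norm w < \<rho>\<close> \<tau>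
        by (simp add: e_def d_def w_def linear_scale[OF linear_deriv])
      have d: "d = \<tau> *\<^sub>R D v + e"
        by (simp add: e_def)
      have "norm d \<le> \<tau> * (norm (D v) + \<kappa> * norm v)"
        using norm_triangle_ineq[of "\<tau> *\<^sub>R D v" e] e \<tau> by (simp add: d algebra_simps)
      then have "(norm d)\<^sup>2 \<le> (\<tau> * (norm (D v) + \<kappa> * norm v))\<^sup>2"
        by (rule power_mono) simp
      then have dK: "(norm d)\<^sup>2 \<le> \<tau> * (\<tau> * K)"
        by (simp add: K_def power_mult_distrib power2_eq_square[of \<tau>])
      have "norm n \<le> norm (n - d)"
        using p y by (auto simp: nearest_def n_def d_def dist_norm algebra_simps)
      then have "(norm n)\<^sup>2 \<le> (norm (n - d))\<^sup>2"
        by (rule power_mono) simp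
      also have "\<dots> = (norm n)\<^sup>2 - 2 * (n \<bullet> d) + (norm d)\<^sup>2"
        by (simp add: power2_norm_eq_inner inner_diff_left inner_diff_right inner_commute[of d n])
      finally have "2 * (n \<bullet> d) \<le> \<tau> * (\<tau> * K)"
        using dK by simp
      moreover have "n \<bullet> d = \<tau> * (n \<bullet> D v) + n \<bullet> e"
        by (simp add: d inner_add_right)
      moreover have "- (n \<bullet> e) \<le> norm n * (\<kappa> * (\<tau> * norm v))"
        using Cauchy_Schwarz_ineq2[of n e] mult_left_mono[OF e norm_ge_zero[of n]] by simp
      ultimately have "\<tau> * (2 * (n \<bullet> D v)) \<le> \<tau> * (2 * (norm n * (\<kappa> * norm v)) + \<tau> * K)"
        by (simp add: algebra_simps)
      then show ?thesis
        using \<tau> by simp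
    qed
    \<comment> \<open>The limit of vanishing step size removes the quadratic term. Since
      \<open>n \<bullet> D v\<close> is the square of the norm of the tangential part, one factor of
      that norm can then be cancelled.\<close>
    have "2 * (n \<bullet> D v) \<le> 2 * (norm n * (\<kappa> * norm v)) + 0 * K"
    proof (rule tendsto_lowerbound)
      show "((\<lambda>\<tau>. 2 * (norm n * (\<kappa> * norm v)) + \<tau> * K) \<longlongrightarrow>
          2 * (norm n * (\<kappa> * norm v)) + 0 * K) (at_right 0)"
        by (intro tendsto_intros)
      show "\<forall>\<^sub>F \<tau> in at_right 0. 2 * (n \<bullet> D v) \<le> 2 * (norm n * (\<kappa> * norm v)) + \<tau> * K"
        using \<tau>0 main by (auto simp: eventually_at_right_field)
    qed simp
    then have "(norm (orthoproj T n))\<^sup>2 \<le> norm n * (\<kappa> * norm v)"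
      using norm_orthoproj_sq[OF T, of n] by (simp add: v inner_commute)
    also have "\<dots> = norm n * \<delta> * (c * norm v)"
      by (simp add: \<kappa>_def)
    also have "\<dots> \<le> norm n * \<delta> * norm (orthoproj T n)"
      using deriv_below[OF v(1)] assms by (intro mult_left_mono) (simp_all add: v)
    finally have "norm (orthoproj T n) * norm (orthoproj T n) \<le> (\<delta> * norm n) * norm (orthoproj T n)"
      by (simp add: power2_eq_square mult_ac)
    then show ?thesis
      using assms by (cases "norm (orthoproj T n) = 0") (auto simp: n_def)
  qed
  then show ?thesis
    using \<eta>(1) by (intro exI[of _ "\<eta>/2"]) simp
qed

text \<open>If \<open>p\<close> and \<open>q\<close> were two nearest points at distance
  \<open>d\<close>, their midpoint would be closer to \<open>B\<close> by an amount of order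
  \<open>s\<^sup>2\<close> in squared distance, \<open>s\<close> being the parameter distance. The
  chart has a point within \<open>C * s\<^sup>2\<close> of that midpoint, and moving there costs
  only terms of order \<open>d * s\<^sup>2\<close> and \<open>s^4\<close>. For small
  \<open>d\<close> and \<open>s\<close> this point of \<open>M\<close> would beat
  \<open>p\<close>.\<close>

lemma chart_nearest_unique:
  "\<exists>\<eta>>0. \<forall>B\<in>ball A \<eta>. \<forall>p q. nearest M B p \<longrightarrow> nearest M B q \<longrightarrow> p = q"
proof -
  have c2: "c/2 > 0"
    using lower_bound_pos by simp
  obtain \<rho>1 where \<rho>1: "0 < \<rho>1" "\<rho>1 < r" and st: "\<And>x y. x \<in> V \<inter> cball 0 \<rho>1 \<Longrightarrow> y \<in> V \<inter> cball 0 \<rho>1 \<Longrightarrow>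
      norm (\<phi> y - \<phi> x - D (y - x)) \<le> c/2 * norm (y - x)"
    using chart_strict[OF c2] by blast
  \<comment> \<open>This radius and \<open>\<eta>'\<close> are tuned so that
    \<open>2 * (C * d) + (C * s)\<^sup>2\<close> is at most \<open>3 * c\<^sup>2 / 64\<close>,
    whereas minimality requires at least \<open>c\<^sup>2 / 16\<close>.\<close>
  define \<rho> where "\<rho> = min \<rho>1 (c / (16 * (C + 1)))"
  have C1: "C + 1 > 0"
    using error_nonneg by simp
  have \<rho>: "\<rho> > 0" "\<rho> \<le> \<rho>1" "(C + 1) * \<rho> \<le> c / 16"
  proof -
    show "\<rho> > 0" "\<rho> \<le> \<rho>1"
      using \<rho>1 lower_bound_pos C1 by (simp_all add: \<rho>_def)
    have "\<rho> \<le> c / (16 * (C + 1))"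
      by (simp add: \<rho>_def)
    then show "(C + 1) * \<rho> \<le> c / 16"
      using C1 by (simp add: field_simps)
  qed
  obtain \<eta> where \<eta>: "\<eta> > 0" "M \<inter> ball A \<eta> \<subseteq> \<phi> ` (V \<inter> ball 0 \<rho>)"
    using chart_onto[OF \<rho>(1)] by blast
  define \<eta>' where "\<eta>' = min (\<eta>/2) (c\<^sup>2 / (64 * (C + 1)))"
  have \<eta>': "\<eta>' > 0" "\<eta>' \<le> \<eta>/2" "(C + 1) * \<eta>' \<le> c\<^sup>2 / 64"
  proof -
    show "\<eta>' > 0"
      using \<eta> lower_bound_pos C1 by (simp add: \<eta>'_def)
    show "\<eta>' \<le> \<eta>/2"
      unfolding \<eta>'_def by (rule min.cobounded1)
    have "\<eta>' \<le> c\<^sup>2 / (64 * (C + 1))"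
      by (simp add: \<eta>'_def)
    then show "(C + 1) * \<eta>' \<le> c\<^sup>2 / 64"
      using C1 by (simp add: field_simps)
  qed
  have "p = q" if B: "B \<in> ball A \<eta>'" and p: "nearest M B p" and q: "nearest M B q" for B p q
  proof (rule ccontr)
    assume "p \<noteq> q"
    have "dist A p < \<eta>" "dist A q < \<eta>"
      using nearest_near(2)[OF p chart_center_mem] nearest_near(2)[OF q chart_center_mem] B \<eta>'(2)
      by (simp_all add: dist_commute)
    then have "p \<in> \<phi> ` (V \<inter> ball 0 \<rho>)" "q \<in> \<phi> ` (V \<inter> ball 0 \<rho>)"
      using \<eta>(2) p q by (auto simp: nearest_def)
    then obtain x y where x: "p = \<phi> x" "x \<in> V" "norm x < \<rho>" and y: "q = \<phi> y" "y \<in> V" "norm y < \<rho>"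
      by auto
    define s where "s = norm (y - x)"
    define d where "d = dist B p"
    have "s > 0"
      using \<open>p \<noteq> q\<close> x y by (auto simp: s_def)
    have d: "dist B q = d"
      using p q by (auto simp: nearest_def d_def intro: antisym)
    have "d < \<eta>'"
      using nearest_near(1)[OF p chart_center_mem] B by (simp add: d_def dist_commute)
    define h where "h = midpoint p q"
    define e where "e = h - \<phi> (midpoint x y)"
    have mem: "x \<in> V \<inter> cball 0 \<rho>1" "y \<in> V \<inter> cball 0 \<rho>1"
      using x y \<rho> by auto
    have pq: "c/2 * s \<le> norm (q - p)"
      using chart_below[OF st[OF mem] order_refl x(2) y(2)] by (simp add: s_def x y)
    have e: "norm e \<le> C * s\<^sup>2"
      using midpoint_estimate[of x y] mem \<rho>1 by (simp add: e_def h_def x y s_def)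
    have mV: "midpoint x y \<in> V"
      unfolding midpoint_def by (intro subspace_scale subspace_add param_subspace x y)
    have "norm (midpoint x y) < r"
    proof -
      have "norm (midpoint x y) \<le> (norm x + norm y) / 2"
        using norm_triangle_ineq[of x y] by (simp add: midpoint_def)
      then show ?thesis
        using x y \<rho> \<rho>1 by simp
    qed
    then have "\<phi> (midpoint x y) \<in> M"
      using chart_into mV by simp
    then have "d \<le> norm ((B - h) + e)"
      using p by (simp add: nearest_def d_def dist_norm e_def)
    then have "d\<^sup>2 \<le> (norm ((B - h) + e))\<^sup>2"
      by (rule power_mono) (simp add: d_def)
    also have "\<dots> = (norm (B - h))\<^sup>2 + 2 * ((B - h) \<bullet> e) + (norm e)\<^sup>2"
      by (simp add: power2_norm_eq_inner inner_add_left inner_add_right inner_commute[of e "B - h"])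
    finally have 1: "d\<^sup>2 \<le> (norm (B - h))\<^sup>2 + 2 * ((B - h) \<bullet> e) + (norm e)\<^sup>2" .
    \<comment> \<open>Parallelogram law for the two equal distances to \<open>p\<close> and
      \<open>q\<close>: the gain at the midpoint is a quarter of the squared chord.\<close>
    have 2: "(norm (B - h))\<^sup>2 = d\<^sup>2 - (norm (q - p))\<^sup>2 / 4"
    proof -
      have par: "(norm (u + w))\<^sup>2 + (norm (u - w))\<^sup>2 = 2 * (norm u)\<^sup>2 + 2 * (norm w)\<^sup>2" for u w :: 'a
        by (simp add: power2_norm_eq_inner inner_add_left inner_add_right inner_diff_left inner_diff_right)
      have a: "B - p = (B - h) + (1/2) *\<^sub>R (q - p)" "B - q = (B - h) - (1/2) *\<^sub>R (q - p)"
        using midpoint_plus_self[of p q]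
        by (simp_all add: h_def midpoint_def algebra_simps flip: scaleR_add_left)
      have "(norm (B - p))\<^sup>2 + (norm (B - q))\<^sup>2 = 2 * (norm (B - h))\<^sup>2 + 2 * (norm ((1/2) *\<^sub>R (q - p)))\<^sup>2"
        unfolding a by (rule par)
      then show ?thesis
        using d by (simp add: d_def dist_norm power_divide)
    qed
    have 3: "norm (B - h) \<le> d"
      by (rule power2_le_imp_le) (simp_all add: 2 d_def)
    have "(B - h) \<bullet> e \<le> norm (B - h) * norm e"
      by (rule norm_cauchy_schwarz)
    also have "\<dots> \<le> d * (C * s\<^sup>2)"
      by (rule mult_mono[OF 3 e]) (simp_all add: d_def)
    finally have 4: "(B - h) \<bullet> e \<le> d * (C * s\<^sup>2)" .
    have 5: "(norm e)\<^sup>2 \<le> (C * s\<^sup>2)\<^sup>2"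
      by (rule power_mono[OF e]) simp
    have 6: "(c/2 * s)\<^sup>2 \<le> (norm (q - p))\<^sup>2"
      by (rule power_mono[OF pq]) (use lower_bound_pos \<open>s > 0\<close> in simp)
    have "(c/2 * s)\<^sup>2 / 4 \<le> 2 * (d * (C * s\<^sup>2)) + (C * s\<^sup>2)\<^sup>2"
      using 1 2 4 5 6 by argo
    then have "s\<^sup>2 * (c\<^sup>2 / 16) \<le> s\<^sup>2 * (2 * (C * d) + (C * s)\<^sup>2)"
      by (simp add: power_mult_distrib power_divide algebra_simps power2_eq_square)
    then have 7: "c\<^sup>2 / 16 \<le> 2 * (C * d) + (C * s)\<^sup>2"
      using \<open>s > 0\<close> by (simp add: mult_le_cancel_left_pos)
    have "C * d \<le> (C + 1) * \<eta>'"
      by (rule mult_mono) (use \<open>d < \<eta>'\<close> error_nonneg in \<open>simp_all add: d_def\<close>)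
    then have 8: "C * d \<le> c\<^sup>2 / 64"
      using \<eta>' by simp
    have "s \<le> 2 * \<rho>"
      using norm_triangle_ineq4[of y x] x y by (simp add: s_def)
    then have "C * s \<le> (C + 1) * (2 * \<rho>)"
      by (intro mult_mono) (use \<open>s > 0\<close> error_nonneg in simp_all)
    then have "C * s \<le> c / 8"
      using \<rho>(3) by simp
    then have "(C * s)\<^sup>2 \<le> (c / 8)\<^sup>2"
      by (rule power_mono) (use \<open>s > 0\<close> error_nonneg in simp)
    then have 9: "(C * s)\<^sup>2 \<le> c\<^sup>2 / 64"
      by (simp add: power_divide)
    have "c\<^sup>2 > 0"
      using lower_bound_pos by simp
    then show False
      using 7 8 9 by argo
  qed
  then show ?thesis
    using \<eta>'(1) by blast
qed

text \<open>Solved by the contraction \<open>x \<mapsto> x - E (P (\<phi> x - A) - t)\<close>, where \<open>E\<close> inverts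
  the derivative of the chart at \<open>0\<close>.\<close>

lemma chart_projects_onto_tangent:
  assumes "\<epsilon> > 0"
  shows "\<exists>\<eta>>0. \<forall>t\<in>T. norm t < \<eta> \<longrightarrow> (\<exists>y\<in>M \<inter> ball A \<epsilon>. orthoproj T (y - A) = t)"
proof -
  note T = subspace_chart_tangent
  have c2: "c/2 > 0"
    using lower_bound_pos by simp
  obtain \<rho>1 where \<rho>1: "0 < \<rho>1" "\<rho>1 < r" and st: "\<And>x y. x \<in> V \<inter> cball 0 \<rho>1 \<Longrightarrow> y \<in> V \<inter> cball 0 \<rho>1 \<Longrightarrow>
      norm (\<phi> y - \<phi> x - D (y - x)) \<le> c/2 * norm (y - x)"
    using chart_strict[OF c2] by blast
  obtain K where K: "K > 0" "\<And>x. norm (D x) \<le> K * norm x"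
    using linear_bounded_pos[OF linear_deriv] by (metis mult.commute)
  \<comment> \<open>The chart is Lipschitz at the origin with constant \<open>K + c/2\<close>, so
    parameters up to \<open>\<rho>\<close> give points within \<open>\<epsilon>\<close> of
    \<open>A\<close>.\<close>
  define \<rho> where "\<rho> = min \<rho>1 (\<epsilon> / (2 * (K + c/2)))"
  have Kc: "K + c/2 > 0"
    using K(1) c2 by simp
  have \<rho>: "\<rho> > 0" "\<rho> \<le> \<rho>1" "(K + c/2) * \<rho> < \<epsilon>"
  proof -
    show "\<rho> > 0" "\<rho> \<le> \<rho>1"
      using \<rho>1 assms Kc by (simp_all add: \<rho>_def)
    have "\<rho> \<le> \<epsilon> / (2 * (K + c/2))"
      by (simp add: \<rho>_def)
    then have "(K + c/2) * \<rho> \<le> \<epsilon> / 2"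
      using Kc by (simp add: pos_le_divide_eq mult_ac)
    then show "(K + c/2) * \<rho> < \<epsilon>"
      using assms by simp
  qed
  have "inj_on D V"
  proof (rule inj_onI)
    fix x y assume xy: "x \<in> V" "y \<in> V" "D x = D y"
    then have "c * norm (x - y) \<le> 0"
      using deriv_below[OF subspace_diff[OF param_subspace xy(1,2)]] by (simp add: linear_diff[OF linear_deriv])
    then show "x = y"
      using lower_bound_pos by (simp add: mult_le_0_iff)
  qed
  then obtain E where linE: "linear E" and E: "\<And>v. v \<in> V \<Longrightarrow> E (D v) = v"
    using linear_exists_left_inverse_on[OF linear_deriv param_subspace] by blast
  have ET: "E t \<in> V" "D (E t) = t" "c * norm (E t) \<le> norm t" if "t \<in> T" for t
  proof -
    obtain v where "v \<in> V" "t = D v"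
      using \<open>t \<in> T\<close> deriv_image by blast
    then show "E t \<in> V" "D (E t) = t" "c * norm (E t) \<le> norm t"
      using E deriv_below by simp_all
  qed
  \<comment> \<open>The bound on \<open>t\<close> puts \<open>\<Psi> 0 = E t\<close> within
    \<open>\<rho> / 2\<close>; as \<open>\<Psi>\<close> halves distances, it then maps
    \<open>S\<close> into itself.\<close>
  have "\<exists>y\<in>M \<inter> ball A \<epsilon>. orthoproj T (y - A) = t" if t: "t \<in> T" "norm t < c * \<rho> / 2" for t
  proof -
    define S where "S = V \<inter> cball 0 \<rho>"
    define \<Psi> where "\<Psi> x = x - E (orthoproj T (\<phi> x - A) - t)" for x
    have S: "x \<in> V" "x \<in> V \<inter> cball 0 \<rho>1" "norm x \<le> \<rho>" if "x \<in> S" for x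
      using that \<rho> by (auto simp: S_def)
    have argT: "orthoproj T (\<phi> x - A) - t \<in> T" for x
      by (intro subspace_diff T orthoproj_mem t)
    \<comment> \<open>\<open>E\<close> undoes \<open>D\<close> on \<open>V\<close>, so only the
      error \<open>e\<close> survives in the difference. Its constant \<open>c/2\<close> against the
      bound \<open>1/c\<close> of \<open>E\<close> on \<open>T\<close> leaves the factor
      \<open>1/2\<close>.\<close>
    have contr: "dist (\<Psi> x) (\<Psi> y) \<le> 1/2 * dist x y" if "x \<in> S" "y \<in> S" for x y
    proof -
      define e where "e = \<phi> x - \<phi> y - D (x - y)"
      have xy: "x - y \<in> V"
        using S that by (intro subspace_diff param_subspace) auto
      have DT: "orthoproj T (D (x - y)) = D (x - y)"
        by (rule orthoproj_ident[OF T]) (use xy deriv_image in blast)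
      have "\<Psi> x - \<Psi> y = (x - y) - E (orthoproj T (\<phi> x - \<phi> y))"
        unfolding \<Psi>_def by (simp add: linear_diff[OF linE] orthoproj_diff[OF T] algebra_simps)
      also have "\<phi> x - \<phi> y = e + D (x - y)"
        by (simp add: e_def)
      also have "(x - y) - E (orthoproj T (e + D (x - y))) = - E (orthoproj T e)"
        using E[OF xy] by (simp add: orthoproj_add[OF T] DT linear_add[OF linE])
      finally have "c * norm (\<Psi> x - \<Psi> y) \<le> norm (orthoproj T e)"
        using ET(3)[OF orthoproj_mem[OF T, of e]] by simp
      also have "\<dots> \<le> c/2 * norm (x - y)"
        using norm_orthoproj_le[OF T, of e] st[OF S(2)[OF that(2)] S(2)[OF that(1)]] by (simp add: e_def)
      also have "\<dots> = c * (1/2 * norm (x - y))"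
        by simp
      finally show ?thesis
        using lower_bound_pos by (simp add: dist_norm)
    qed
    have "0 \<in> S"
      using subspace_0[OF param_subspace] \<rho> by (simp add: S_def)
    have "\<Psi> 0 = E t"
      by (simp add: \<Psi>_def chart_center orthoproj_0[OF T] linear_neg[OF linE])
    then have "c * norm (\<Psi> 0) < c * (\<rho> / 2)"
      using ET(3)[OF t(1)] t(2) by simp
    then have \<Psi>0: "norm (\<Psi> 0) \<le> \<rho> / 2"
      using lower_bound_pos by simp
    have maps: "\<Psi> ` S \<subseteq> S"
    proof safe
      fix x assume x: "x \<in> S"
      have "norm (\<Psi> x - \<Psi> 0) \<le> \<rho> / 2"
        using contr[OF x \<open>0 \<in> S\<close>] S(3)[OF x] by (simp add: dist_norm)
      then have "norm (\<Psi> x) \<le> \<rho>"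
        using \<Psi>0 norm_triangle_ineq[of "\<Psi> x - \<Psi> 0" "\<Psi> 0"] by simp
      moreover have "\<Psi> x \<in> V"
        unfolding \<Psi>_def by (intro subspace_diff param_subspace S(1) x ET(1) argT)
      ultimately show "\<Psi> x \<in> S"
        by (simp add: S_def)
    qed
    have "complete S"
      unfolding S_def complete_eq_closed by (intro closed_Int closed_subspace param_subspace closed_cball)
    then have "\<exists>!x\<in>S. \<Psi> x = x"
      using \<open>0 \<in> S\<close> maps contr by (intro Banach_fix[where c = "1/2"]) auto
    then obtain x where x: "x \<in> S" "\<Psi> x = x"
      by blast
    then have "E (orthoproj T (\<phi> x - A) - t) = 0"
      by (simp add: \<Psi>_def)
    then have "orthoproj T (\<phi> x - A) - t = 0"
      using ET(2)[OF argT] linear_0[OF linear_deriv] by metis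
    moreover have "\<phi> x \<in> M"
      using chart_into S[OF x(1)] \<rho> \<rho>1 by simp
    moreover have "dist A (\<phi> x) < \<epsilon>"
    proof -
      have "norm (\<phi> x - A - D x) \<le> c/2 * norm x"
        using st[of 0 x] S(2)[OF x(1)] S(2)[OF \<open>0 \<in> S\<close>] by (simp add: chart_center)
      then have "norm (\<phi> x - A) \<le> K * norm x + c/2 * norm x"
        using K(2)[of x] norm_triangle_ineq[of "\<phi> x - A - D x" "D x"] by simp
      also have "\<dots> = (K + c/2) * norm x"
        by (simp add: algebra_simps)
      also have "\<dots> \<le> (K + c/2) * \<rho>"
        using S(3)[OF x(1)] Kc by (intro mult_left_mono) auto
      finally show ?thesis
        using \<rho>(3) by (simp add: dist_norm norm_minus_commute)
    qed
    ultimately show ?thesis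
      by auto
  qed
  then show ?thesis
    using \<rho> lower_bound_pos by (intro exI[of _ "c * \<rho> / 2"]) auto
qed

end

section \<open>Tangent spaces and angles\<close>

text \<open>The chart-free form in which near-tangency enters the analysis of the iteration. The
  last clause gives at most one nearest point; existence is supplied by closedness.\<close>

definition tangent_approx :: "'a::euclidean_space set \<Rightarrow> 'a set \<Rightarrow> 'a \<Rightarrow> real \<Rightarrow> real \<Rightarrow> bool" where
  "tangent_approx M T A \<delta> r \<longleftrightarrow>
     (\<forall>x\<in>M \<inter> ball A r. \<forall>y\<in>M \<inter> ball A r.
        norm ((y - x) - orthoproj T (y - x)) \<le> \<delta> * norm (y - x)) \<and>
     (\<forall>B\<in>ball A r. \<forall>p. nearest M B p \<longrightarrow> norm (orthoproj T (B - p)) \<le> \<delta> * norm (B - p)) \<and>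
     (\<forall>B\<in>ball A r. \<forall>p q. nearest M B p \<longrightarrow> nearest M B q \<longrightarrow> p = q)"

text \<open>Every direction of \<open>T\<close> is realised by points of \<open>M\<close>
  arbitrarily near \<open>A\<close>. This complements the secant clause of
  \<open>tangent_approx\<close>, which survives enlarging \<open>T\<close>.\<close>

definition projects_onto_tangent :: "'a::euclidean_space set \<Rightarrow> 'a set \<Rightarrow> 'a \<Rightarrow> bool" where
  "projects_onto_tangent M T A \<longleftrightarrow>
     (\<forall>\<epsilon>>0. \<exists>\<eta>>0. \<forall>t\<in>T. norm t < \<eta> \<longrightarrow> (\<exists>y\<in>M \<inter> ball A \<epsilon>. orthoproj T (y - A) = t))"

lemma tangent_approxD:
  assumes "tangent_approx M T A \<delta> r"
  shows "x \<in> M \<Longrightarrow> y \<in> M \<Longrightarrow> dist A x < r \<Longrightarrow> dist A y < r \<Longrightarrow>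
      norm ((y - x) - orthoproj T (y - x)) \<le> \<delta> * norm (y - x)"
    and "dist A B < r \<Longrightarrow> nearest M B p \<Longrightarrow> norm (orthoproj T (B - p)) \<le> \<delta> * norm (B - p)"
    and "dist A B < r \<Longrightarrow> nearest M B p \<Longrightarrow> nearest M B q \<Longrightarrow> p = q"
  using assms unfolding tangent_approx_def by (simp_all add: Ball_def)

lemma tangent_approx_antimono:
  assumes "tangent_approx M T A \<delta> r" "r' \<le> r"
  shows "tangent_approx M T A \<delta> r'"
proof -
  have "ball A r' \<subseteq> ball A r"
    using assms(2) by (rule subset_ball)
  then show ?thesis
    using assms(1) unfolding tangent_approx_def by blast
qed

lemma chart_tangent_approx:
  assumes "chart_estimates M T A V \<phi> D c C r" "\<delta> > 0"
  shows "\<exists>\<rho>>0. tangent_approx M T A \<delta> \<rho>"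
proof -
  obtain r1 r2 r3 where r: "r1 > 0" "r2 > 0" "r3 > 0"
    and 1: "\<forall>x\<in>M \<inter> ball A r1. \<forall>y\<in>M \<inter> ball A r1.
        norm ((y - x) - orthoproj T (y - x)) \<le> \<delta> * norm (y - x)"
    and 2: "\<forall>B\<in>ball A r2. \<forall>p. nearest M B p \<longrightarrow> norm (orthoproj T (B - p)) \<le> \<delta> * norm (B - p)"
    and 3: "\<forall>B\<in>ball A r3. \<forall>p q. nearest M B p \<longrightarrow> nearest M B q \<longrightarrow> p = q"
    using chart_secants[OF assms] chart_normals[OF assms] chart_nearest_unique[OF assms(1)] by blast
  define \<rho> where "\<rho> = min r1 (min r2 r3)"
  have "ball A \<rho> \<subseteq> ball A r1" "ball A \<rho> \<subseteq> ball A r2" "ball A \<rho> \<subseteq> ball A r3"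
    by (rule subset_ball; simp add: \<rho>_def)+
  then have "tangent_approx M T A \<delta> \<rho>"
    unfolding tangent_approx_def using 1 2 3 by blast
  moreover have "\<rho> > 0"
    using r by (simp add: \<rho>_def)
  ultimately show ?thesis
    by blast
qed

lemma local_chart_tangent:
  fixes M :: "'a::euclidean_space set"
  assumes chart: "local_chart 2 m M A V r \<phi>"
    and T: "T = frechet_derivative \<phi> (at 0 within V \<inter> ball 0 r) ` V"
  shows "subspace T" and "projects_onto_tangent M T A"
    and "\<delta> > 0 \<Longrightarrow> \<exists>\<rho>>0. tangent_approx M T A \<delta> \<rho>"
proof -
  obtain D c C \<rho> where ce: "chart_estimates M T A V \<phi> D c C \<rho>"
    using local_chart_imp_chart_estimates[OF assms] by blast
  show "subspace T"
    by (rule subspace_chart_tangent[OF ce])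
  show "projects_onto_tangent M T A"
    unfolding projects_onto_tangent_def using chart_projects_onto_tangent[OF ce] by blast
  show "\<delta> > 0 \<Longrightarrow> \<exists>\<rho>>0. tangent_approx M T A \<delta> \<rho>"
    by (rule chart_tangent_approx[OF ce])
qed

text \<open>The offset \<open>y - A - \<tau> a\<close> is normal to \<open>T\<close>, so it does not spoil orthogonality to
  subspaces of \<open>T\<close>.\<close>

lemma point_over_tangent_vector:
  fixes M :: "'a::euclidean_space set"
  assumes T: "subspace T" and A: "A \<in> M" and onto: "projects_onto_tangent M T A"
    and approx: "\<And>\<delta>. \<delta> > 0 \<Longrightarrow> \<exists>r>0. tangent_approx M T A \<delta> r"
    and a: "a \<in> T" and \<delta>: "0 < \<delta>" "\<delta> \<le> 1/2" and r: "r > 0"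
  shows "\<exists>\<tau>0>0. \<forall>\<tau>. 0 < \<tau> \<and> \<tau> < \<tau>0 \<longrightarrow> (\<exists>y\<in>M \<inter> ball A r. orthoproj T (y - A) = \<tau> *\<^sub>R a \<and>
           norm (y - A - \<tau> *\<^sub>R a) \<le> 2 * \<delta> * (\<tau> * norm a))"
proof -
  obtain \<rho> where \<rho>: "\<rho> > 0" "tangent_approx M T A \<delta> \<rho>"
    using approx \<delta> by blast
  define \<epsilon> where "\<epsilon> = min r \<rho>"
  have \<epsilon>: "\<epsilon> > 0" "\<epsilon> \<le> r" "\<epsilon> \<le> \<rho>"
    using r \<rho> by (auto simp: \<epsilon>_def)
  obtain \<eta> where \<eta>: "\<eta> > 0" "\<And>t. t \<in> T \<Longrightarrow> norm t < \<eta> \<Longrightarrow> \<exists>y\<in>M \<inter> ball A \<epsilon>. orthoproj T (y - A) = t"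
    using onto \<epsilon>(1) unfolding projects_onto_tangent_def by blast
  define \<tau>0 where "\<tau>0 = \<eta> / (norm a + 1)"
  have na: "norm a + 1 > 0"
    by (simp add: add_nonneg_pos)
  have "\<exists>y\<in>M \<inter> ball A r. orthoproj T (y - A) = \<tau> *\<^sub>R a \<and>
           norm (y - A - \<tau> *\<^sub>R a) \<le> 2 * \<delta> * (\<tau> * norm a)" if \<tau>: "0 < \<tau>" "\<tau> < \<tau>0" for \<tau>
  proof -
    have "\<tau> * norm a \<le> \<tau> * (norm a + 1)"
      using \<tau> by simp
    also have "\<dots> < \<eta>"
      using \<tau>(2) na by (simp add: \<tau>0_def field_simps)
    finally have "norm (\<tau> *\<^sub>R a) < \<eta>"
      using \<tau> by simp
    moreover have "\<tau> *\<^sub>R a \<in> T"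
      by (rule subspace_scale[OF T a])
    ultimately obtain y where y: "y \<in> M" "y \<in> ball A \<epsilon>" "orthoproj T (y - A) = \<tau> *\<^sub>R a"
      using \<eta>(2) by blast
    have "norm ((y - A) - orthoproj T (y - A)) \<le> \<delta> * norm (y - A)"
      using tangent_approxD(1)[OF \<rho>(2) A y(1)] \<rho>(1) y(2) \<epsilon>(3) by simp
    then have 1: "norm (y - A - \<tau> *\<^sub>R a) \<le> \<delta> * norm (y - A)"
      by (simp add: y)
    have "norm (y - A) \<le> norm (y - A - \<tau> *\<^sub>R a) + \<tau> * norm a"
      using norm_triangle_ineq[of "y - A - \<tau> *\<^sub>R a" "\<tau> *\<^sub>R a"] \<tau> by simp
    \<comment> \<open>As \<open>\<delta> \<le> 1/2\<close>, the offset is at most half of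
      \<open>norm (y - A)\<close> and can be absorbed.\<close>
    moreover have "\<delta> * norm (y - A) \<le> 1/2 * norm (y - A)"
      using \<delta> by (intro mult_right_mono) auto
    ultimately have "norm (y - A) \<le> 2 * (\<tau> * norm a)"
      using 1 by simp
    then have "\<delta> * norm (y - A) \<le> \<delta> * (2 * (\<tau> * norm a))"
      using \<delta> by (intro mult_left_mono) auto
    then have "norm (y - A - \<tau> *\<^sub>R a) \<le> 2 * \<delta> * (\<tau> * norm a)"
      using 1 by simp
    then show ?thesis
      using y \<epsilon>(2) by auto
  qed
  moreover have "\<tau>0 > 0"
    using \<eta> na by (simp add: \<tau>0_def)
  ultimately show ?thesis
    by blast
qed

text \<open>A point of \<open>M\<close> over a small multiple of \<open>t\<close> is also a point of
  \<open>N\<close>, so its secant is almost in \<open>U\<close>, and therefore so is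
  \<open>t\<close>. The relative error is at most \<open>4 * \<delta>\<close> for every small
  \<open>\<delta>\<close>, hence zero.\<close>

lemma tangent_space_mono:
  fixes M N :: "'a::euclidean_space set"
  assumes T: "subspace T" and U: "subspace U" and A: "A \<in> M" and MN: "M \<subseteq> N"
    and onto: "projects_onto_tangent M T A"
    and approxM: "\<And>\<delta>. \<delta> > 0 \<Longrightarrow> \<exists>r>0. tangent_approx M T A \<delta> r"
    and approxN: "\<And>\<delta>. \<delta> > 0 \<Longrightarrow> \<exists>r>0. tangent_approx N U A \<delta> r"
  shows "T \<subseteq> U"
proof
  fix t assume t: "t \<in> T"
  have bound: "norm (t - orthoproj U t) \<le> 4 * \<delta> * norm t" if \<delta>: "0 < \<delta>" "\<delta> < 1/2" for \<delta>
  proof -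
    obtain r where r: "r > 0" "tangent_approx N U A \<delta> r"
      using approxN \<delta> by blast
    obtain \<tau>0 where \<tau>0: "\<tau>0 > 0" "\<And>\<tau>. 0 < \<tau> \<Longrightarrow> \<tau> < \<tau>0 \<Longrightarrow> (\<exists>y\<in>M \<inter> ball A r. orthoproj T (y - A) = \<tau> *\<^sub>R t \<and>
           norm (y - A - \<tau> *\<^sub>R t) \<le> 2 * \<delta> * (\<tau> * norm t))"
      using point_over_tangent_vector[OF T A onto approxM t _ _ r(1), of \<delta>] \<delta> by auto
    define \<tau> where "\<tau> = \<tau>0 / 2"
    have \<tau>: "0 < \<tau>" "\<tau> < \<tau>0"
      using \<tau>0(1) by (simp_all add: \<tau>_def)
    obtain y where y: "y \<in> M" "y \<in> ball A r" "norm (y - A - \<tau> *\<^sub>R t) \<le> 2 * \<delta> * (\<tau> * norm t)"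
      using \<tau>0(2)[OF \<tau>] by blast
    define d where "d = y - A"
    define e where "e = d - \<tau> *\<^sub>R t"
    have e: "norm e \<le> 2 * \<delta> * (\<tau> * norm t)"
      using y by (simp add: e_def d_def)
    have dt: "\<tau> *\<^sub>R t = d - e"
      by (simp add: e_def)
    have "2 * \<delta> * (\<tau> * norm t) \<le> 1 * (\<tau> * norm t)"
      using \<delta> \<tau> by (intro mult_right_mono) auto
    moreover have "norm d \<le> norm e + \<tau> * norm t"
      using norm_triangle_ineq[of e "\<tau> *\<^sub>R t"] \<tau> by (simp add: e_def)
    ultimately have nd: "norm d \<le> 2 * (\<tau> * norm t)"
      using e by linarith
    have "norm (d - orthoproj U d) \<le> \<delta> * norm d"
      using tangent_approxD(1)[OF r(2), of A y] r(1) y A MN unfolding d_def by auto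
    also have "\<dots> \<le> \<delta> * (2 * (\<tau> * norm t))"
      using nd \<delta> by (intro mult_left_mono) auto
    finally have 1: "norm (d - orthoproj U d) \<le> 2 * \<delta> * (\<tau> * norm t)"
      by simp
    have "\<tau> *\<^sub>R (t - orthoproj U t) = (d - orthoproj U d) - (e - orthoproj U e)"
      using orthoproj_diff[OF U, of d e] orthoproj_scale[OF U, of \<tau> t] dt
      by (simp add: scaleR_diff_right algebra_simps)
    then have "norm (\<tau> *\<^sub>R (t - orthoproj U t)) \<le> norm (d - orthoproj U d) + norm (e - orthoproj U e)"
      using norm_triangle_ineq4 by metis
    also have "\<dots> \<le> 2 * \<delta> * (\<tau> * norm t) + 2 * \<delta> * (\<tau> * norm t)"
      using 1 norm_orthoproj_compl_le[OF U, of e] e by (intro add_mono) auto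
    finally have "\<tau> * norm (t - orthoproj U t) \<le> \<tau> * (4 * \<delta> * norm t)"
      using \<tau> by simp
    then show ?thesis
      using \<tau> by simp
  qed
  have "norm (t - orthoproj U t) \<le> 4 * 0 * norm t"
  proof (rule tendsto_lowerbound)
    show "((\<lambda>\<delta>. 4 * \<delta> * norm t) \<longlongrightarrow> 4 * 0 * norm t) (at_right 0)"
      by (intro tendsto_intros)
    show "\<forall>\<^sub>F \<delta> in at_right 0. norm (t - orthoproj U t) \<le> 4 * \<delta> * norm t"
      unfolding eventually_at_right_field using bound by (intro exI[of _ "1/2"]) simp
  qed simp
  then have "t = orthoproj U t"
    by simp
  then show "t \<in> U"
    using orthoproj_mem[OF U, of t] by simp
qed

text \<open>Carries the cosine bound from secants at \<open>A\<close> to tangent vectors: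
  \<open>a\<close> and \<open>b\<close> are replaced by secants over small multiples of them. By
  homogeneity one scale \<open>\<tau>\<close> suffices for each \<open>\<delta>\<close>, and the
  limit is taken in \<open>\<delta>\<close> alone.\<close>

lemma tangent_angle:
  fixes M1 M2 :: "'a::euclidean_space set"
  assumes T1: "subspace T1" and T2: "subspace T2" and TT: "T \<subseteq> T1" "T \<subseteq> T2"
    and A: "A \<in> M1" "A \<in> M2"
    and onto: "projects_onto_tangent M1 T1 A" "projects_onto_tangent M2 T2 A"
    and approx1: "\<And>\<delta>. \<delta> > 0 \<Longrightarrow> \<exists>r>0. tangent_approx M1 T1 A \<delta> r"
    and approx2: "\<And>\<delta>. \<delta> > 0 \<Longrightarrow> \<exists>r>0. tangent_approx M2 T2 A \<delta> r"
    and "r > 0" "c \<ge> 0"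
    and angle: "\<And>d1 d2. A + d1 \<in> M1 \<Longrightarrow> A + d2 \<in> M2 \<Longrightarrow> 0 < norm d1 \<Longrightarrow> norm d1 < r \<Longrightarrow>
      0 < norm d2 \<Longrightarrow> norm d2 < r \<Longrightarrow> (\<And>t. t \<in> T \<Longrightarrow> d1 \<bullet> t = 0) \<Longrightarrow> (\<And>t. t \<in> T \<Longrightarrow> d2 \<bullet> t = 0) \<Longrightarrow>
      d1 \<bullet> d2 \<le> c * (norm d1 * norm d2)"
    and a: "a \<in> T1" "\<And>t. t \<in> T \<Longrightarrow> a \<bullet> t = 0" and b: "b \<in> T2" "\<And>t. t \<in> T \<Longrightarrow> b \<bullet> t = 0"
  shows "a \<bullet> b \<le> c * (norm a * norm b)"
proof (cases "a = 0 \<or> b = 0")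
  case True
  then show ?thesis
    by auto
next
  case False
  then have ab0: "a \<noteq> 0" "b \<noteq> 0"
    by auto
  define m where "m = norm a * norm b"
  have bound: "a \<bullet> b \<le> (c * (1 + 2 * \<delta>)\<^sup>2 + 4 * \<delta> * (1 + 2 * \<delta>) + (2 * \<delta>)\<^sup>2) * m" if \<delta>: "0 < \<delta>" "\<delta> < 1/2" for \<delta>
  proof -
    obtain \<tau>1 where \<tau>1: "\<tau>1 > 0" "\<And>\<tau>. 0 < \<tau> \<Longrightarrow> \<tau> < \<tau>1 \<Longrightarrow> (\<exists>y\<in>M1 \<inter> ball A r. orthoproj T1 (y - A) = \<tau> *\<^sub>R a \<and>
           norm (y - A - \<tau> *\<^sub>R a) \<le> 2 * \<delta> * (\<tau> * norm a))"
      using point_over_tangent_vector[OF T1 A(1) onto(1) approx1 a(1) _ _ \<open>r > 0\<close>, of \<delta>] \<delta> by auto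
    obtain \<tau>2 where \<tau>2: "\<tau>2 > 0" "\<And>\<tau>. 0 < \<tau> \<Longrightarrow> \<tau> < \<tau>2 \<Longrightarrow> (\<exists>y\<in>M2 \<inter> ball A r. orthoproj T2 (y - A) = \<tau> *\<^sub>R b \<and>
           norm (y - A - \<tau> *\<^sub>R b) \<le> 2 * \<delta> * (\<tau> * norm b))"
      using point_over_tangent_vector[OF T2 A(2) onto(2) approx2 b(1) _ _ \<open>r > 0\<close>, of \<delta>] \<delta> by auto
    define \<tau> where "\<tau> = min \<tau>1 \<tau>2 / 2"
    have \<tau>: "0 < \<tau>" "\<tau> < \<tau>1" "\<tau> < \<tau>2"
      using \<tau>1(1) \<tau>2(1) by (auto simp: \<tau>_def)
    obtain y1 where y1: "y1 \<in> M1" "y1 \<in> ball A r" "orthoproj T1 (y1 - A) = \<tau> *\<^sub>R a"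
        "norm (y1 - A - \<tau> *\<^sub>R a) \<le> 2 * \<delta> * (\<tau> * norm a)"
      using \<tau>1(2)[OF \<tau>(1,2)] by blast
    obtain y2 where y2: "y2 \<in> M2" "y2 \<in> ball A r" "orthoproj T2 (y2 - A) = \<tau> *\<^sub>R b"
        "norm (y2 - A - \<tau> *\<^sub>R b) \<le> 2 * \<delta> * (\<tau> * norm b)"
      using \<tau>2(2)[OF \<tau>(1,3)] by blast
    define d1 d2 where "d1 = y1 - A" and "d2 = y2 - A"
    define e1 e2 where "e1 = d1 - \<tau> *\<^sub>R a" and "e2 = d2 - \<tau> *\<^sub>R b"
    define \<alpha> \<beta> where "\<alpha> = \<tau> * norm a" and "\<beta> = \<tau> * norm b"
    have nn: "\<alpha> \<ge> 0" "\<beta> \<ge> 0"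
      using \<tau> by (simp_all add: \<alpha>_def \<beta>_def)
    have e: "norm e1 \<le> 2 * \<delta> * \<alpha>" "norm e2 \<le> 2 * \<delta> * \<beta>"
      using y1 y2 by (simp_all add: e1_def e2_def d1_def d2_def \<alpha>_def \<beta>_def)
    have d: "norm d1 \<le> (1 + 2 * \<delta>) * \<alpha>" "norm d2 \<le> (1 + 2 * \<delta>) * \<beta>"
      using e norm_triangle_ineq[of e1 "\<tau> *\<^sub>R a"] norm_triangle_ineq[of e2 "\<tau> *\<^sub>R b"] \<tau>
      by (simp_all add: e1_def e2_def \<alpha>_def \<beta>_def algebra_simps)
    \<comment> \<open>The secants must be exactly orthogonal to \<open>T\<close> for
      \<open>angle\<close> to apply. They are, because their offsets from the tangent vectors are
      normal to \<open>T1\<close> and \<open>T2\<close>, both of which contain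
      \<open>T\<close>.\<close>
    have perp1: "d1 \<bullet> t = 0" if "t \<in> T" for t
      using inner_orthoproj_compl[OF T1, of t d1] a(2)[OF that] TT that y1(3)
      by (auto simp: d1_def inner_diff_left)
    have perp2: "d2 \<bullet> t = 0" if "t \<in> T" for t
      using inner_orthoproj_compl[OF T2, of t d2] b(2)[OF that] TT that y2(3)
      by (auto simp: d2_def inner_diff_left)
    have "d1 \<noteq> 0"
      using y1(3) ab0 \<tau> orthoproj_0[OF T1] by (auto simp: d1_def)
    moreover have "d2 \<noteq> 0"
      using y2(3) ab0 \<tau> orthoproj_0[OF T2] by (auto simp: d2_def)
    ultimately have "d1 \<bullet> d2 \<le> c * (norm d1 * norm d2)"
      using y1 y2 by (intro angle perp1 perp2) (simp_all add: d1_def d2_def dist_norm norm_minus_commute)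
    also have "\<dots> \<le> c * (((1 + 2 * \<delta>) * \<alpha>) * ((1 + 2 * \<delta>) * \<beta>))"
      using \<open>c \<ge> 0\<close> \<delta> nn by (intro mult_left_mono mult_mono d) auto
    finally have 1: "d1 \<bullet> d2 \<le> c * (((1 + 2 * \<delta>) * \<alpha>) * ((1 + 2 * \<delta>) * \<beta>))" .
    have 2: "- (d1 \<bullet> e2) \<le> ((1 + 2 * \<delta>) * \<alpha>) * (2 * \<delta> * \<beta>)"
    proof -
      have "- (d1 \<bullet> e2) \<le> norm d1 * norm e2"
        using Cauchy_Schwarz_ineq2[of d1 e2] by simp
      also have "\<dots> \<le> ((1 + 2 * \<delta>) * \<alpha>) * (2 * \<delta> * \<beta>)"
        using \<delta> nn by (intro mult_mono d e) auto
      finally show ?thesis .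
    qed
    have 3: "- (e1 \<bullet> d2) \<le> (2 * \<delta> * \<alpha>) * ((1 + 2 * \<delta>) * \<beta>)"
    proof -
      have "- (e1 \<bullet> d2) \<le> norm e1 * norm d2"
        using Cauchy_Schwarz_ineq2[of e1 d2] by simp
      also have "\<dots> \<le> (2 * \<delta> * \<alpha>) * ((1 + 2 * \<delta>) * \<beta>)"
        using \<delta> nn by (intro mult_mono d e) auto
      finally show ?thesis .
    qed
    have 4: "e1 \<bullet> e2 \<le> (2 * \<delta> * \<alpha>) * (2 * \<delta> * \<beta>)"
    proof -
      have "e1 \<bullet> e2 \<le> norm e1 * norm e2"
        by (rule norm_cauchy_schwarz)
      also have "\<dots> \<le> (2 * \<delta> * \<alpha>) * (2 * \<delta> * \<beta>)"
        using \<delta> nn by (intro mult_mono e) auto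
      finally show ?thesis .
    qed
    have "(\<tau> *\<^sub>R a) \<bullet> (\<tau> *\<^sub>R b) = (d1 - e1) \<bullet> (d2 - e2)"
      by (simp add: e1_def e2_def)
    also have "\<dots> = d1 \<bullet> d2 - d1 \<bullet> e2 - e1 \<bullet> d2 + e1 \<bullet> e2"
      by (simp add: inner_diff_left inner_diff_right)
    also have "\<dots> \<le> (c * (1 + 2 * \<delta>)\<^sup>2 + 4 * \<delta> * (1 + 2 * \<delta>) + (2 * \<delta>)\<^sup>2) * (\<alpha> * \<beta>)"
      using 1 2 3 4 by (simp add: power2_eq_square algebra_simps)
    finally have "\<tau>\<^sup>2 * (a \<bullet> b) \<le> \<tau>\<^sup>2 * ((c * (1 + 2 * \<delta>)\<^sup>2 + 4 * \<delta> * (1 + 2 * \<delta>) + (2 * \<delta>)\<^sup>2) * m)"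
      by (simp add: m_def \<alpha>_def \<beta>_def power2_eq_square mult_ac)
    then show ?thesis
      using \<tau>(1) by simp
  qed
  have "a \<bullet> b \<le> (c * (1 + 2 * 0)\<^sup>2 + 4 * 0 * (1 + 2 * 0) + (2 * 0)\<^sup>2) * m"
  proof (rule tendsto_lowerbound)
    show "((\<lambda>\<delta>. (c * (1 + 2 * \<delta>)\<^sup>2 + 4 * \<delta> * (1 + 2 * \<delta>) + (2 * \<delta>)\<^sup>2) * m) \<longlongrightarrow>
        (c * (1 + 2 * 0)\<^sup>2 + 4 * 0 * (1 + 2 * 0) + (2 * 0)\<^sup>2) * m) (at_right 0)"
      by (intro tendsto_intros)
    show "\<forall>\<^sub>F \<delta> in at_right 0. a \<bullet> b \<le> (c * (1 + 2 * \<delta>)\<^sup>2 + 4 * \<delta> * (1 + 2 * \<delta>) + (2 * \<delta>)\<^sup>2) * m"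
      unfolding eventually_at_right_field using bound by (intro exI[of _ "1/2"]) simp
  qed simp
  then show ?thesis
    by (simp add: m_def)
qed

section \<open>Convergence of the angle suprema\<close>

lemma angle_cosines_mono: "r \<le> r' \<Longrightarrow> angle_cosines p M1 M2 A r \<subseteq> angle_cosines p M1 M2 A r'"
  unfolding angle_cosines_def by (fastforce intro: less_le_trans)

lemma angle_cosines_bounds:
  assumes "x \<in> angle_cosines p M1 M2 A r"
  shows "-1 \<le> x" "x \<le> 1"
proof -
  obtain B1 B2 where B: "x = (B1 - A) \<bullet> (B2 - A) / (norm (B1 - A) * norm (B2 - A))"
      "0 < norm (B1 - A)" "0 < norm (B2 - A)"
    using assms unfolding angle_cosines_def by blast
  define u v where "u = B1 - A" and "v = B2 - A"
  have x: "x = u \<bullet> v / (norm u * norm v)" and uv: "norm u * norm v > 0"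
    using B by (simp_all add: u_def v_def)
  have "\<bar>u \<bullet> v\<bar> \<le> norm u * norm v"
    by (rule Cauchy_Schwarz_ineq2)
  then have "- (norm u * norm v) \<le> u \<bullet> v" "u \<bullet> v \<le> norm u * norm v"
    by linarith+
  then show "-1 \<le> x" "x \<le> 1"
    using uv unfolding x by (simp_all only: pos_le_divide_eq pos_divide_le_eq mult_1 mult_minus_left)
qed

text \<open>\<open>Lim\<close> carries information only when the limit exists, so convergence comes
  first. If the set of cosines is empty for some radius, the function is eventually 0; otherwise it
  is monotone in the radius and bounded below by -1, and tends to its infimum.\<close>

lemma cos_angle_less_1D:
  fixes M1 M2 :: "'a::euclidean_space set"
  assumes "cos_angle p M1 M2 A < 1"
  obtains c r where "0 \<le> c" "c < 1" "r > 0" "\<And>x. x \<in> angle_cosines p M1 M2 A r \<Longrightarrow> x \<le> c"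
proof -
  define X where "X = angle_cosines p M1 M2 A"
  define f where "f r = (if X r = {} then 0 else Sup (X r))" for r
  have bdd: "bdd_above (X r)" for r
    using angle_cosines_bounds(2) unfolding X_def bdd_above_def by blast
  have "\<exists>L. (f \<longlongrightarrow> L) (at_right 0)"
  proof (cases "\<exists>r>0. X r = {}")
    case True
    then obtain r where r: "r > 0" "X r = {}"
      by blast
    have "\<forall>\<^sub>F s in at_right 0. 0 = f s"
      unfolding eventually_at_right_field
      using r angle_cosines_mono[of _ r p M1 M2 A] by (intro exI[of _ r]) (auto simp: f_def X_def less_imp_le)
    then show ?thesis
      using Lim_transform_eventually[OF tendsto_const] by blast
  next
    case False
    then have f: "f r = Sup (X r)" "X r \<noteq> {}" if "r > 0" for r
      using that by (auto simp: f_def)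
    have mono: "f r \<le> f s" if "0 < r" "r \<le> s" for r s
      using that f[of r] f[of s] cSup_subset_mono[OF _ bdd, of "X r" s] angle_cosines_mono[of r s p M1 M2 A]
      by (simp add: X_def)
    have low: "-1 \<le> f r" if r: "r > 0" for r
    proof -
      obtain x where x: "x \<in> X r"
        using f(2)[OF r] by blast
      then have "-1 \<le> x"
        unfolding X_def by (rule angle_cosines_bounds(1))
      also have "x \<le> f r"
        unfolding f(1)[OF r] by (rule cSup_upper[OF x bdd])
      finally show ?thesis .
    qed
    define L where "L = Inf (f ` {0<..})"
    have bb: "bdd_below (f ` {0<..})"
      using low by (intro bdd_belowI[of _ "-1"]) auto
    have "(f \<longlongrightarrow> L) (at_right 0)"
    proof (rule order_tendstoI)
      fix l assume "l < L"
      have "l < f r" if "r > 0" for r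
        using \<open>l < L\<close> cInf_lower[OF _ bb, of "f r"] that by (force simp: L_def)
      then show "\<forall>\<^sub>F r in at_right 0. l < f r"
        unfolding eventually_at_right_field by (intro exI[of _ 1]) simp
    next
      fix u assume "L < u"
      then obtain r where r: "r > 0" "f r < u"
        using cInf_lessD[of "f ` {0<..}" u] by (force simp: L_def)
      then show "\<forall>\<^sub>F r in at_right 0. f r < u"
        unfolding eventually_at_right_field
        using mono by (intro exI[of _ r]) (auto intro: le_less_trans less_imp_le)
    qed
    then show ?thesis
      by blast
  qed
  then obtain L where L: "(f \<longlongrightarrow> L) (at_right 0)"
    by blast
  have "cos_angle p M1 M2 A = Lim (at_right 0) f"
    unfolding cos_angle_def Let_def f_def[abs_def] X_def ..
  also have "\<dots> = L"
    by (rule tendsto_Lim[OF _ L]) simp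
  finally have "L < 1"
    using assms by simp
  then have "\<forall>\<^sub>F r in at_right 0. f r < 1"
    using order_tendstoD(2)[OF L] by simp
  then obtain b where b: "b > 0" "\<And>r. 0 < r \<Longrightarrow> r < b \<Longrightarrow> f r < 1"
    unfolding eventually_at_right_field by blast
  define r where "r = b / 2"
  have r: "r > 0" "f r < 1"
    using b by (simp_all add: r_def)
  show thesis
  proof
    \<comment> \<open>The supremum may be negative, while later estimates multiply inequalities by
      \<open>c\<close> and need it nonnegative.\<close>
    show "0 \<le> max 0 (f r)" "max 0 (f r) < 1" "r > 0"
      using r by auto
    fix x assume "x \<in> angle_cosines p M1 M2 A r"
    then show "x \<le> max 0 (f r)"
      using cSup_upper[OF _ bdd, of x r] by (auto simp: f_def X_def)
  qed
qed

section \<open>Alternating projections\<close>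

text \<open>Here \<open>w\<close> is the iterate minus its nearest point in the intersection,
  \<open>v\<close> the next iterate minus the same point, and \<open>w'\<close> the next iterate
  minus its own nearest point, so \<open>v - w'\<close> is the displacement of nearest points. It is
  almost in \<open>T\<close>, being a secant of the intersection, and its component in
  \<open>T\<close> is small because \<open>w\<close> and \<open>w'\<close> are almost normal to
  \<open>T\<close>.\<close>

lemma alternating_step:
  fixes T U :: "'a::euclidean_space set"
  assumes T: "subspace T" and U: "subspace U" and TU: "T \<subseteq> U" and \<delta>: "0 < \<delta>" "\<delta> \<le> 1/2"
    and w: "norm (orthoproj T w) \<le> \<delta> * norm w"
    and v: "norm (v - orthoproj U v) \<le> \<delta> * norm v"
    and wv: "norm (orthoproj U (w - v)) \<le> \<delta> * norm (w - v)" "norm (w - v) \<le> norm w"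
    and w': "norm (orthoproj T w') \<le> \<delta> * norm w'" "norm w' \<le> norm v"
    and vw': "norm ((v - w') - orthoproj T (v - w')) \<le> \<delta> * norm (v - w')"
  shows "norm w' \<le> 2 * norm w" and "norm (v - w') \<le> 12 * \<delta> * norm w"
    and "norm w' \<le> norm (orthoproj U w) + 3 * \<delta> * norm w"
proof -
  have v2: "norm v \<le> 2 * norm w"
    using norm_triangle_ineq4[of w "w - v"] wv(2) by simp
  then show w2: "norm w' \<le> 2 * norm w"
    using w'(2) by simp
  have "norm (v - orthoproj U w) \<le> norm (v - orthoproj U v) + norm (orthoproj U (w - v))"
    using norm_triangle_ineq4[of "v - orthoproj U v" "orthoproj U (w - v)"]
    by (simp add: orthoproj_diff[OF U])
  also have "\<dots> \<le> \<delta> * (2 * norm w) + \<delta> * norm w"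
    by (intro add_mono order_trans[OF v] order_trans[OF wv(1)] mult_left_mono v2 wv(2)) (use \<delta> in auto)
  finally have vU: "norm (v - orthoproj U w) \<le> 3 * \<delta> * norm w"
    by simp
  have "norm v \<le> norm (orthoproj U w) + norm (v - orthoproj U w)"
    using norm_triangle_ineq[of "orthoproj U w" "v - orthoproj U w"] by simp
  then show "norm w' \<le> norm (orthoproj U w) + 3 * \<delta> * norm w"
    using vU w'(2) by simp
  \<comment> \<open>Tower property: projecting \<open>w\<close> to \<open>U\<close> first leaves its
    \<open>T\<close> component unchanged.\<close>
  have "orthoproj T v = orthoproj T w + orthoproj T (v - orthoproj U w)"
    by (simp add: orthoproj_diff[OF T] orthoproj_orthoproj_subset[OF T U TU])
  then have "norm (orthoproj T v) \<le> norm (orthoproj T w) + norm (orthoproj T (v - orthoproj U w))"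
    by (simp add: norm_triangle_ineq)
  also have "\<dots> \<le> \<delta> * norm w + 3 * \<delta> * norm w"
    by (intro add_mono w order_trans[OF norm_orthoproj_le[OF T] vU])
  finally have Tv: "norm (orthoproj T v) \<le> 4 * \<delta> * norm w"
    by simp
  have Tw': "norm (orthoproj T w') \<le> 2 * \<delta> * norm w"
  proof -
    have "\<delta> * norm w' \<le> \<delta> * (2 * norm w)"
      using \<delta> by (intro mult_left_mono w2) auto
    then show ?thesis
      using w'(1) by simp
  qed
  have "norm (v - w') \<le> norm ((v - w') - orthoproj T (v - w')) + norm (orthoproj T (v - w'))"
    using norm_triangle_ineq[of "(v - w') - orthoproj T (v - w')" "orthoproj T (v - w')"] by simp
  also have "norm (orthoproj T (v - w')) \<le> norm (orthoproj T v) + norm (orthoproj T w')"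
    by (simp add: orthoproj_diff[OF T] norm_triangle_ineq4)
  finally have "norm (v - w') \<le> \<delta> * norm (v - w') + 6 * \<delta> * norm w"
    using vw' Tv Tw' by simp
  \<comment> \<open>Absorbing this term into the left side doubles 6 to 12.\<close>
  moreover have "\<delta> * norm (v - w') \<le> 1/2 * norm (v - w')"
    using \<delta> by (intro mult_right_mono) auto
  ultimately show "norm (v - w') \<le> 12 * \<delta> * norm w"
    by simp
qed

text \<open>\<open>U\<close> is tangent to the set projected onto next, \<open>U'\<close> to the set
  already containing the iterate. With \<open>a\<close> and \<open>b\<close> the parts of the two
  projections orthogonal to \<open>T\<close>, the squared norm of \<open>orthoproj U w\<close>
  splits into \<open>a \<bullet> b\<close>, controlled by the angle, and two terms of order
  \<open>\<delta>\<close>, since \<open>w\<close> is close to \<open>b\<close> and almost normal to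
  \<open>T\<close>.\<close>

lemma orthoproj_contraction:
  fixes T U U' :: "'a::euclidean_space set"
  assumes T: "subspace T" and U: "subspace U" and U': "subspace U'" and TU: "T \<subseteq> U" "T \<subseteq> U'"
    and \<delta>: "0 < \<delta>" "\<delta> \<le> 1" and c: "c \<ge> 0"
    and angle: "\<And>a b. a \<in> U \<Longrightarrow> b \<in> U' \<Longrightarrow> (\<And>t. t \<in> T \<Longrightarrow> a \<bullet> t = 0) \<Longrightarrow>
        (\<And>t. t \<in> T \<Longrightarrow> b \<bullet> t = 0) \<Longrightarrow> a \<bullet> b \<le> c * (norm a * norm b)"
    and w: "norm (orthoproj T w) \<le> \<delta> * norm w" "norm (w - orthoproj U' w) \<le> \<delta> * norm w"
  shows "norm (orthoproj U w) \<le> sqrt (c + 3 * \<delta>) * norm w"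
proof -
  define a where "a = orthoproj U w - orthoproj T w"
  define b where "b = orthoproj U' w - orthoproj T w"
  have aU: "a = orthoproj U (w - orthoproj T w)" and bU: "b = orthoproj U' (w - orthoproj T w)"
    using orthoproj_ident[OF U, of "orthoproj T w"] orthoproj_ident[OF U', of "orthoproj T w"]
      orthoproj_mem[OF T, of w] TU
    by (auto simp: a_def b_def orthoproj_diff[OF U] orthoproj_diff[OF U'])
  have na: "norm a \<le> norm w" and nb: "norm b \<le> norm w"
    unfolding aU bU
    by (rule order_trans[OF norm_orthoproj_le[OF U] norm_orthoproj_compl_le[OF T]]
             order_trans[OF norm_orthoproj_le[OF U'] norm_orthoproj_compl_le[OF T]])+
  have perp_a: "a \<bullet> t = 0" if "t \<in> T" for t
    using inner_orthoproj_compl[OF U, of t w] inner_orthoproj_compl[OF T that, of w] TU that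
    by (auto simp: a_def inner_diff_left)
  have perp_b: "b \<bullet> t = 0" if "t \<in> T" for t
    using inner_orthoproj_compl[OF U', of t w] inner_orthoproj_compl[OF T that, of w] TU that
    by (auto simp: b_def inner_diff_left)
  have "a \<bullet> b \<le> c * (norm a * norm b)"
    by (rule angle[OF _ _ perp_a perp_b])
       (simp_all add: aU bU orthoproj_mem[OF U] orthoproj_mem[OF U'])
  also have "\<dots> \<le> c * (norm w * norm w)"
    using c by (intro mult_left_mono mult_mono na nb) auto
  finally have 1: "a \<bullet> b \<le> c * (norm w)\<^sup>2"
    by (simp add: power2_eq_square)
  have "norm (w - b) \<le> norm (w - orthoproj U' w) + norm (orthoproj T w)"
    using norm_triangle_ineq[of "w - orthoproj U' w" "orthoproj T w"] by (simp add: b_def algebra_simps)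
  then have wb: "norm (w - b) \<le> 2 * \<delta> * norm w"
    using w by simp
  have "a \<bullet> (w - b) \<le> norm a * norm (w - b)"
    by (rule norm_cauchy_schwarz)
  also have "\<dots> \<le> norm w * (2 * \<delta> * norm w)"
    by (intro mult_mono na wb) auto
  finally have 2: "a \<bullet> (w - b) \<le> 2 * \<delta> * (norm w)\<^sup>2"
    by (simp add: power2_eq_square mult_ac)
  have "(norm (orthoproj T w))\<^sup>2 \<le> (\<delta> * norm w)\<^sup>2"
    by (rule power_mono[OF w(1)]) simp
  also have "\<dots> = \<delta> * (\<delta> * (norm w)\<^sup>2)"
    by (simp add: power2_eq_square mult_ac)
  also have "\<dots> \<le> \<delta> * (1 * (norm w)\<^sup>2)"
    using \<delta> by (intro mult_left_mono mult_right_mono) auto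
  finally have 3: "orthoproj T w \<bullet> w \<le> \<delta> * (norm w)\<^sup>2"
    by (simp add: norm_orthoproj_sq[OF T])
  have "(norm (orthoproj U w))\<^sup>2 = a \<bullet> b + a \<bullet> (w - b) + orthoproj T w \<bullet> w"
    by (simp add: norm_orthoproj_sq[OF U] a_def inner_diff_left inner_diff_right)
  also have "\<dots> \<le> (c + 3 * \<delta>) * (norm w)\<^sup>2"
    using 1 2 3 by (simp add: algebra_simps)
  also have "\<dots> = (sqrt (c + 3 * \<delta>) * norm w)\<^sup>2"
    using c \<delta> by (simp add: power_mult_distrib)
  finally show ?thesis
    by (rule power2_le_imp_le) (use c \<delta> in simp)
qed

lemma geometric_increments_limit:
  fixes z :: "nat \<Rightarrow> 'a::banach"
  assumes inc: "\<And>k. norm (z (Suc k) - z k) \<le> K * q ^ k" and q: "0 \<le> q" "q < 1"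
  obtains L where "z \<longlonglongrightarrow> L" "norm (L - z 0) \<le> K / (1 - q)"
proof -
  have geo: "(\<lambda>k. K * q ^ k) sums (K * (1 / (1 - q)))"
    by (intro sums_mult geometric_sums) (use q in simp)
  have sm: "summable (\<lambda>k. z (Suc k) - z k)"
    by (rule summable_comparison_test'[OF sums_summable[OF geo]]) (rule inc)
  then have "(\<lambda>n. \<Sum>k<n. z (Suc k) - z k) \<longlonglongrightarrow> (\<Sum>k. z (Suc k) - z k)"
    by (rule summable_LIMSEQ)
  then have "(\<lambda>n. z n - z 0) \<longlonglongrightarrow> (\<Sum>k. z (Suc k) - z k)"
    by (simp add: sum_lessThan_telescope)
  then have "(\<lambda>n. (z n - z 0) + z 0) \<longlonglongrightarrow> (\<Sum>k. z (Suc k) - z k) + z 0"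
    by (intro tendsto_intros)
  then have "z \<longlonglongrightarrow> (\<Sum>k. z (Suc k) - z k) + z 0"
    by simp
  moreover have "norm ((\<Sum>k. z (Suc k) - z k) + z 0 - z 0) \<le> K / (1 - q)"
    using norm_suminf_le[OF inc sums_summable[OF geo]] sums_unique[OF geo] by simp
  ultimately show thesis
    by (rule that)
qed

section \<open>Nearest points of closed sets\<close>

lemma nearest_closest_point:
  assumes "closed M" "M \<noteq> {}"
  shows "nearest M B (closest_point M B)"
  using closest_point_exists[OF assms] by (simp add: nearest_def)

lemma proj_well_defined_tangent_approx:
  assumes "closed M" "M \<noteq> {}" "tangent_approx M T A \<delta> r" "dist A B < r"
  shows "proj_well_defined M B"
  unfolding proj_well_defined_def nearest_def[symmetric]
  using nearest_closest_point[OF assms(1,2)] tangent_approxD(3)[OF assms(3,4)] by blast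

text \<open>An induction keeps all iterates within \<open>r / 4\<close> of \<open>A\<close>, where
  the step estimates hold, while their distances to the intersection decay geometrically. The
  nearest points \<open>z k\<close> then have summable increments, and the iterates share their
  limit.\<close>

lemma alternating_projections_local:
  fixes M1 M2 T T1 T2 :: "'a::euclidean_space set" and A B :: 'a
  assumes cl: "closed M1" "closed M2" and A: "A \<in> M1 \<inter> M2"
    and T: "subspace T" and T1: "subspace T1" and T2: "subspace T2" and TT: "T \<subseteq> T1" "T \<subseteq> T2"
    and ap: "tangent_approx (M1 \<inter> M2) T A \<delta> r" "tangent_approx M1 T1 A \<delta> r" "tangent_approx M2 T2 A \<delta> r"
    and \<delta>: "0 < \<delta>" "\<delta> \<le> 1/2" and r: "r > 0" and c: "c \<ge> 0"
    and angle: "\<And>a b. a \<in> T1 \<Longrightarrow> b \<in> T2 \<Longrightarrow> (\<And>t. t \<in> T \<Longrightarrow> a \<bullet> t = 0) \<Longrightarrow>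
        (\<And>t. t \<in> T \<Longrightarrow> b \<bullet> t = 0) \<Longrightarrow> a \<bullet> b \<le> c * (norm a * norm b)"
    and q: "1/2 \<le> q" "q < 1" "sqrt (c + 3 * \<delta>) + 3 * \<delta> \<le> q" "48 * \<delta> \<le> 1 - q"
    and B: "norm (B - A) < r / 28"
  shows "alt_proj_well_defined M1 M2 B" and "proj_well_defined (M1 \<inter> M2) B"
    and "\<exists>L\<in>M1 \<inter> M2. alt_proj M1 M2 B \<longlonglongrightarrow> L \<and>
           norm (L - closest_point (M1 \<inter> M2) B)
             \<le> 48 * \<delta> / (1 - q) * norm (B - closest_point (M1 \<inter> M2) B)"
proof -
  define M where "M = M1 \<inter> M2"
  \<comment> \<open>Index \<open>k\<close> refers to the set onto which \<open>b k\<close> is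
    projected, so it is \<open>b (Suc k)\<close> that lies in \<open>N k\<close>.\<close>
  define N where "N k = (if even k then M1 else M2)" for k :: nat
  define U where "U k = (if even k then T1 else T2)" for k :: nat
  define b where "b = alt_proj M1 M2 B"
  define z where "z k = closest_point M (b k)" for k
  define d where "d k = norm (b k - z k)" for k
  have clM: "closed M" and AM: "A \<in> M"
    using cl A by (auto simp: M_def)
  have N: "closed (N k)" "A \<in> N k" "M \<subseteq> N k" for k
    using cl A by (auto simp: N_def M_def)
  have U: "subspace (U k)" "T \<subseteq> U k" for k
    using T1 T2 TT by (auto simp: U_def)
  have apM: "tangent_approx M T A \<delta> r" and apN: "tangent_approx (N k) (U k) A \<delta> r" for k
    using ap by (auto simp: M_def N_def U_def)
  have zn: "nearest M (b k) (z k)" for k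
    unfolding z_def by (rule nearest_closest_point[OF clM]) (use AM in blast)
  have zM: "z k \<in> M" for k
    using zn by (simp add: nearest_def)
  have zN: "z k \<in> N j" for k j
    using zM N(3) by blast
  have b0: "b 0 = B" and bSuc: "b (Suc k) = closest_point (N k) (b k)" for k
    by (simp_all add: b_def N_def)
  have bn: "nearest (N k) (b k) (b (Suc k))" for k
    unfolding bSuc by (rule nearest_closest_point[OF N(1)]) (use N(2) in blast)
  have bN: "b (Suc k) \<in> N k" for k
    using bn by (simp add: nearest_def)
  \<comment> \<open>Each passage to a nearest point at most doubles the distance to
    \<open>A\<close>; starting below \<open>r / 4\<close>, the two passages to
    \<open>b (Suc k)\<close> and \<open>z (Suc k)\<close> stay below \<open>r\<close>.\<close>
  have step: "d (Suc k) \<le> 2 * d k" "norm (z (Suc k) - z k) \<le> 12 * \<delta> * d k"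
    "d (Suc k) \<le> norm (orthoproj (U k) (b k - z k)) + 3 * \<delta> * d k"
    and dist_z: "dist A (z k) < r"
    if near: "dist A (b k) < r / 4" for k
  proof -
    have dz: "dist A (z k) < r / 2"
      using nearest_near(2)[OF zn AM, of k] near by (simp add: dist_commute)
    have db: "dist A (b (Suc k)) < r / 2"
      using nearest_near(2)[OF bn N(2), of k] near by (simp add: dist_commute)
    have dz': "dist A (z (Suc k)) < r"
      using nearest_near(2)[OF zn AM, of "Suc k"] db by (simp add: dist_commute)
    show "dist A (z k) < r"
      using dz r by simp
    define w v w' where "w = b k - z k" and "v = b (Suc k) - z k" and "w' = b (Suc k) - z (Suc k)"
    have wv: "w - v = b k - b (Suc k)" and vw': "v - w' = z (Suc k) - z k"
      by (simp_all add: w_def v_def w'_def)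
    have 1: "norm (orthoproj T w) \<le> \<delta> * norm w"
      unfolding w_def by (rule tangent_approxD(2)[OF apM _ zn]) (use near r in simp)
    have 2: "norm (v - orthoproj (U k) v) \<le> \<delta> * norm v"
      unfolding v_def by (rule tangent_approxD(1)[OF apN]) (use zN bN dz db r in auto)
    have 3: "norm (orthoproj (U k) (w - v)) \<le> \<delta> * norm (w - v)"
      unfolding wv by (rule tangent_approxD(2)[OF apN _ bn]) (use near r in simp)
    have 4: "norm (w - v) \<le> norm w"
      using bn[of k] zN[of k k] unfolding wv unfolding w_def nearest_def by (auto simp: dist_norm)
    have 5: "norm (orthoproj T w') \<le> \<delta> * norm w'"
      unfolding w'_def by (rule tangent_approxD(2)[OF apM _ zn]) (use db r in simp)
    have 6: "norm w' \<le> norm v"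
      using zn[of "Suc k"] zM[of k] unfolding w'_def v_def nearest_def by (auto simp: dist_norm)
    have 7: "norm ((v - w') - orthoproj T (v - w')) \<le> \<delta> * norm (v - w')"
      unfolding vw' by (rule tangent_approxD(1)[OF apM]) (use zM dz dz' r in auto)
    note * = alternating_step[OF T U(1,2) \<delta> 1 2 3 4 5 6 7]
    show "d (Suc k) \<le> 2 * d k" "norm (z (Suc k) - z k) \<le> 12 * \<delta> * d k"
      "d (Suc k) \<le> norm (orthoproj (U k) (b k - z k)) + 3 * \<delta> * d k"
      using * unfolding vw' by (simp_all add: d_def w_def w'_def)
  qed
  \<comment> \<open>The starting point is arbitrary, so contraction by \<open>q\<close> begins only
    once an iterate lies on one of the sets.\<close>
  have contract: "d (Suc (Suc k)) \<le> q * d (Suc k)" if near: "dist A (b (Suc k)) < r / 4" for k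
  proof -
    define w where "w = b (Suc k) - z (Suc k)"
    have 1: "norm (orthoproj T w) \<le> \<delta> * norm w"
      unfolding w_def by (rule tangent_approxD(2)[OF apM _ zn]) (use near r in simp)
    have 2: "norm (w - orthoproj (U k) w) \<le> \<delta> * norm w"
      unfolding w_def by (rule tangent_approxD(1)[OF apN]) (use zN bN near dist_z[OF near] r in auto)
    \<comment> \<open>The parity of \<open>k\<close> decides which tangent space comes first;
      symmetry of the inner product covers both orders.\<close>
    have ang: "a \<bullet> b' \<le> c * (norm a * norm b')"
      if "a \<in> U (Suc k)" "b' \<in> U k" "\<And>t. t \<in> T \<Longrightarrow> a \<bullet> t = 0" "\<And>t. t \<in> T \<Longrightarrow> b' \<bullet> t = 0" for a b'
      using angle[of a b'] angle[of b' a] that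
      by (cases "even k") (auto simp: U_def inner_commute mult.commute)
    have "norm (orthoproj (U (Suc k)) w) \<le> sqrt (c + 3 * \<delta>) * norm w"
      by (rule orthoproj_contraction[OF T U(1) U(1) U(2) U(2) \<delta>(1) _ c ang 1 2]) (use \<delta> in auto)
    then have "d (Suc (Suc k)) \<le> sqrt (c + 3 * \<delta>) * d (Suc k) + 3 * \<delta> * d (Suc k)"
      using step(3)[OF near] by (simp add: w_def d_def)
    also have "\<dots> = (sqrt (c + 3 * \<delta>) + 3 * \<delta>) * d (Suc k)"
      by (simp add: algebra_simps)
    also have "\<dots> \<le> q * d (Suc k)"
      using q(3) by (rule mult_right_mono) (simp add: d_def)
    finally show ?thesis .
  qed
  define s where "s = norm (B - A)"
  have d0: "d 0 \<le> s" "0 \<le> d 0"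
    using nearest_near(1)[OF zn AM, of 0] by (simp_all add: d_def s_def b0 dist_norm)
  have z0: "dist A (z 0) \<le> 2 * s"
    using nearest_near(2)[OF zn AM, of 0] by (simp add: s_def b0 dist_norm)
  have q0: "0 \<le> q" "q \<le> 1" "0 < 1 - q"
    using q by auto
  have sum_le: "48 * \<delta> * (\<Sum>i<k. q ^ i) \<le> 1" for k
  proof -
    have "(\<Sum>i<k. q ^ i) = (1 - q ^ k) / (1 - q)"
      using q by (simp add: sum_gp_strict)
    also have "\<dots> \<le> 1 / (1 - q)"
      using q0 by (intro divide_right_mono) auto
    finally have "48 * \<delta> * (\<Sum>i<k. q ^ i) \<le> (1 - q) * (1 / (1 - q))"
      using q(4) q0 by (intro mult_mono sum_nonneg) auto
    then show ?thesis
      using q0 by simp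
  qed
  \<comment> \<open>The first step only gives the factor 2, which \<open>4 * q\<close> dominates
    because \<open>q \<ge> 1/2\<close>; this explains the 4, and 48 is 12 times 4. The drift of the
    nearest points stays below \<open>d 0\<close>, so the distance of an iterate to \<open>A\<close>
    is at most \<open>2 * s + s + 4 * s\<close>, and \<open>7 * s < r / 4\<close> is the reason for
    \<open>r / 28\<close>.\<close>
  have inv: "dist A (b k) < r / 4 \<and> d k \<le> 4 * q ^ k * d 0 \<and>
      norm (z k - z 0) \<le> 48 * \<delta> * (\<Sum>i<k. q ^ i) * d 0" for k
  proof (induction k)
    case 0
    then show ?case
      using B r d0(2) by (simp add: b0 dist_norm norm_minus_commute)
  next
    case (Suc k)
    then have near: "dist A (b k) < r / 4" and dk: "d k \<le> 4 * q ^ k * d 0"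
      and zk: "norm (z k - z 0) \<le> 48 * \<delta> * (\<Sum>i<k. q ^ i) * d 0"
      by auto
    have dS: "d (Suc k) \<le> 4 * q ^ Suc k * d 0"
    proof (cases k)
      case 0
      have "2 * d 0 \<le> 4 * q * d 0"
        using q(1) d0(2) by (intro mult_right_mono) auto
      then show ?thesis
        using step(1)[OF near] 0 by simp
    next
      case (Suc j)
      have "d (Suc k) \<le> q * d k"
        using contract[of j] near Suc by simp
      also have "\<dots> \<le> q * (4 * q ^ k * d 0)"
        using dk q0 by (intro mult_left_mono) auto
      finally show ?thesis
        by (simp add: mult_ac)
    qed
    have "norm (z (Suc k) - z k) \<le> 12 * \<delta> * (4 * q ^ k * d 0)"
      by (rule order_trans[OF step(2)[OF near] mult_left_mono[OF dk]]) (use \<delta> in simp)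
    then have "norm (z (Suc k) - z 0) \<le> 12 * \<delta> * (4 * q ^ k * d 0) + 48 * \<delta> * (\<Sum>i<k. q ^ i) * d 0"
      using zk norm_triangle_ineq[of "z (Suc k) - z k" "z k - z 0"] by simp
    also have "\<dots> = 48 * \<delta> * (\<Sum>i<Suc k. q ^ i) * d 0"
      by (simp add: algebra_simps)
    finally have zS: "norm (z (Suc k) - z 0) \<le> 48 * \<delta> * (\<Sum>i<Suc k. q ^ i) * d 0" .
    also have "\<dots> \<le> 1 * d 0"
      by (rule mult_right_mono[OF sum_le d0(2)])
    finally have zs: "dist (z 0) (z (Suc k)) \<le> s"
      using d0(1) by (simp add: dist_norm norm_minus_commute)
    have "d (Suc k) \<le> 4 * 1 * d 0"
      using dS q0 d0(2) by (meson mult_left_mono mult_right_mono order_trans power_le_one zero_le_numeral)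
    then have ds: "dist (z (Suc k)) (b (Suc k)) \<le> 4 * s"
      using d0(1) by (simp add: d_def dist_norm norm_minus_commute)
    have "dist A (b (Suc k)) \<le> dist A (z 0) + dist (z 0) (z (Suc k)) + dist (z (Suc k)) (b (Suc k))"
      using dist_triangle[of A "b (Suc k)" "z 0"] dist_triangle[of "z 0" "b (Suc k)" "z (Suc k)"] by simp
    also have "\<dots> \<le> 7 * s"
      using z0 zs ds by simp
    also have "\<dots> < r / 4"
      using B by (simp add: s_def)
    finally show ?case
      using dS zS by simp
  qed
  have near: "dist A (b k) < r" for k
    using inv[of k] r by auto
  show "alt_proj_well_defined M1 M2 B"
    unfolding alt_proj_well_defined_def N_def[symmetric] b_def[symmetric]
    using proj_well_defined_tangent_approx[OF N(1) _ apN near] N(2) by blast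
  show "proj_well_defined (M1 \<inter> M2) B"
    using proj_well_defined_tangent_approx[OF clM _ apM near[of 0]] AM by (auto simp: M_def b0)
  have inc: "norm (z (Suc k) - z k) \<le> (48 * \<delta> * d 0) * q ^ k" for k
  proof -
    have "norm (z (Suc k) - z k) \<le> 12 * \<delta> * d k"
      using step(2) inv by blast
    also have "\<dots> \<le> 12 * \<delta> * (4 * q ^ k * d 0)"
      using inv[of k] \<delta> by (intro mult_left_mono) auto
    finally show ?thesis
      by (simp add: mult_ac)
  qed
  obtain L where L: "z \<longlonglongrightarrow> L" "norm (L - z 0) \<le> 48 * \<delta> * d 0 / (1 - q)"
    using geometric_increments_limit[OF inc q0(1) q(2)] by blast
  \<comment> \<open>The gap to the nearest points vanishes, so \<open>b\<close> converges to the
    limit of \<open>z\<close>, which closedness places in the intersection.\<close>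
  have "(\<lambda>k. b k - z k) \<longlonglongrightarrow> 0"
  proof (rule Lim_null_comparison)
    show "\<forall>\<^sub>F k in sequentially. norm (b k - z k) \<le> 4 * q ^ k * d 0"
      using inv by (simp add: d_def)
    have "(\<lambda>k. 4 * q ^ k * d 0) \<longlonglongrightarrow> 4 * 0 * d 0"
      by (intro tendsto_intros LIMSEQ_power_zero) (use q in simp)
    then show "(\<lambda>k. 4 * q ^ k * d 0) \<longlonglongrightarrow> 0"
      by simp
  qed
  then have "(\<lambda>k. (b k - z k) + z k) \<longlonglongrightarrow> 0 + L"
    by (rule tendsto_add[OF _ L(1)])
  then have "b \<longlonglongrightarrow> L"
    by simp
  moreover have "L \<in> M"
    using closed_sequentially[OF clM _ L(1)] zM by blast
  moreover have "norm (L - closest_point M B) \<le> 48 * \<delta> / (1 - q) * norm (B - closest_point M B)"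
    using L(2) by (simp add: d_def z_def b0)
  ultimately show "\<exists>L\<in>M1 \<inter> M2. alt_proj M1 M2 B \<longlonglongrightarrow> L \<and>
           norm (L - closest_point (M1 \<inter> M2) B)
             \<le> 48 * \<delta> / (1 - q) * norm (B - closest_point (M1 \<inter> M2) B)"
    unfolding M_def b_def by blast
qed

section \<open>From charts at the point to the choice of constants\<close>

lemma locally_manifold_at_tangent:
  fixes M :: "'a::euclidean_space set"
  assumes "locally_manifold_at 2 m M A"
  shows "subspace (tangent_space 2 M A)" and "projects_onto_tangent M (tangent_space 2 M A) A"
    and "\<delta> > 0 \<Longrightarrow> \<exists>\<rho>>0. tangent_approx M (tangent_space 2 M A) A \<delta> \<rho>"
proof -
  have "\<exists>T m V r \<phi>. local_chart 2 m M A V r \<phi> \<and>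
      T = frechet_derivative \<phi> (at 0 within V \<inter> ball 0 r) ` V"
    using assms unfolding locally_manifold_at_def by blast
  \<comment> \<open>The chosen tangent space is the derivative range of some chart, and the three
    facts hold for the range of any chart.\<close>
  then have "\<exists>m V r \<phi>. local_chart 2 m M A V r \<phi> \<and>
      tangent_space 2 M A = frechet_derivative \<phi> (at 0 within V \<inter> ball 0 r) ` V"
    unfolding tangent_space_def by (rule someI_ex)
  then obtain m V r \<phi> where "local_chart 2 m M A V r \<phi>"
      "tangent_space 2 M A = frechet_derivative \<phi> (at 0 within V \<inter> ball 0 r) ` V"
    by blast
  note * = local_chart_tangent[OF this]
  show "subspace (tangent_space 2 M A)" and "projects_onto_tangent M (tangent_space 2 M A) A"
    and "\<delta> > 0 \<Longrightarrow> \<exists>\<rho>>0. tangent_approx M (tangent_space 2 M A) A \<delta> \<rho>"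
    by (rule *; assumption)+
qed

lemma alternating_projections_epsilon:
  fixes M1 M2 :: "'a::euclidean_space set" and A :: 'a
  assumes cl: "closed M1" "closed M2" and nt: "non_tangential 2 M1 M2 A" and "\<epsilon> > 0"
  shows "\<exists>s>0. \<forall>B. norm (B - A) < s \<longrightarrow>
            alt_proj_well_defined M1 M2 B \<and>
            proj_well_defined (M1 \<inter> M2) B \<and>
            (\<exists>B_inf \<in> M1 \<inter> M2. alt_proj M1 M2 B \<longlonglongrightarrow> B_inf \<and>
               (B \<notin> M1 \<inter> M2 \<longrightarrow>
                  norm (B_inf - closest_point (M1 \<inter> M2) B)
                    < \<epsilon> * norm (B - closest_point (M1 \<inter> M2) B)))"
proof -
  have A: "A \<in> M1 \<inter> M2" and cosl: "cos_angle 2 M1 M2 A < 1"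
    using nt by (auto simp: non_tangential_def regular_point_def)
  obtain m1 m2 m where man: "locally_manifold_at 2 m1 M1 A" "locally_manifold_at 2 m2 M2 A"
      "locally_manifold_at 2 m (M1 \<inter> M2) A"
    using nt by (auto simp: non_tangential_def regular_point_def)
  define T T1 T2 where "T = tangent_space 2 (M1 \<inter> M2) A" and "T1 = tangent_space 2 M1 A"
    and "T2 = tangent_space 2 M2 A"
  note t1 = locally_manifold_at_tangent[OF man(1), folded T1_def]
    and t2 = locally_manifold_at_tangent[OF man(2), folded T2_def]
    and t = locally_manifold_at_tangent[OF man(3), folded T_def]
  have TT: "T \<subseteq> T1" "T \<subseteq> T2"
    by (rule tangent_space_mono[OF t(1) t1(1) A _ t(2) t(3) t1(3)]
             tangent_space_mono[OF t(1) t2(1) A _ t(2) t(3) t2(3)]; simp)+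
  obtain c r0 where c: "0 \<le> c" "c < 1" and r0: "r0 > 0"
    and cos: "\<And>x. x \<in> angle_cosines 2 M1 M2 A r0 \<Longrightarrow> x \<le> c"
    using cos_angle_less_1D[OF cosl] by blast
  have secants: "d1 \<bullet> d2 \<le> c * (norm d1 * norm d2)"
    if d: "A + d1 \<in> M1" "A + d2 \<in> M2" "0 < norm d1" "norm d1 < r0" "0 < norm d2" "norm d2 < r0"
      "\<And>t. t \<in> T \<Longrightarrow> d1 \<bullet> t = 0" "\<And>t. t \<in> T \<Longrightarrow> d2 \<bullet> t = 0" for d1 d2
  proof -
    have "d1 \<in> orthogonal_comp T" "d2 \<in> orthogonal_comp T"
      using d(7,8) by (auto simp: orthogonal_comp_def orthogonal_def inner_commute)
    then have "d1 \<bullet> d2 / (norm d1 * norm d2) \<in> angle_cosines 2 M1 M2 A r0"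
      unfolding angle_cosines_def T_def[symmetric] mem_Collect_eq using d
      by (intro exI[of _ "A + d1"] exI[of _ "A + d2"]) simp
    then have "d1 \<bullet> d2 / (norm d1 * norm d2) \<le> c"
      by (rule cos)
    then show ?thesis
      using mult_pos_pos[OF d(3,5)] by (simp only: pos_divide_le_eq)
  qed
  have angle: "a \<bullet> b \<le> c * (norm a * norm b)"
    if "a \<in> T1" "b \<in> T2" "\<And>t. t \<in> T \<Longrightarrow> a \<bullet> t = 0" "\<And>t. t \<in> T \<Longrightarrow> b \<bullet> t = 0" for a b
    using that A
    by (intro tangent_angle[OF t1(1) t2(1) TT _ _ t1(2) t2(2) t1(3) t2(3) r0 c(1) secants]) auto
  \<comment> \<open>The square of \<open>\<kappa>\<close> is halfway from \<open>c\<close> to 1, and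
    \<open>q\<close> is halfway from \<open>\<kappa>\<close> to 1: one gap absorbs
    \<open>3 * \<delta>\<close> under the root, the other the \<open>3 * \<delta>\<close> outside
    it.\<close>
  define \<kappa> where "\<kappa> = sqrt ((1 + c) / 2)"
  define q where "q = (1 + \<kappa>) / 2"
  have \<kappa>: "0 \<le> \<kappa>" "\<kappa> < 1"
    using c by (simp_all add: \<kappa>_def)
  have q: "1/2 \<le> q" "q < 1"
    using \<kappa> by (simp_all add: q_def)
  \<comment> \<open>The entries serve, in order, the absorption steps, the two gaps just described,
    the bound on the total drift, and the final estimate with \<open>\<epsilon> / 2\<close>.\<close>
  define \<delta> where "\<delta> = Min {1/2, (1 - c) / 6, (1 - \<kappa>) / 6, (1 - q) / 48, \<epsilon> * (1 - q) / 96}"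
  have "\<delta> > 0"
    using c \<kappa> q \<open>\<epsilon> > 0\<close> by (simp add: \<delta>_def)
  moreover have "\<delta> \<le> 1/2" "\<delta> \<le> (1 - c) / 6" "\<delta> \<le> (1 - \<kappa>) / 6" "\<delta> \<le> (1 - q) / 48"
      "\<delta> \<le> \<epsilon> * (1 - q) / 96"
    unfolding \<delta>_def by (rule Min_le; simp)+
  ultimately have \<delta>: "\<delta> > 0" "\<delta> \<le> 1/2" "\<delta> \<le> (1 - c) / 6" "\<delta> \<le> (1 - \<kappa>) / 6"
      "\<delta> \<le> (1 - q) / 48" "\<delta> \<le> \<epsilon> * (1 - q) / 96"
    by blast+
  have "sqrt (c + 3 * \<delta>) \<le> \<kappa>"
    unfolding \<kappa>_def by (rule real_sqrt_le_mono) (use \<delta>(3) in \<open>simp add: field_simps\<close>)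
  then have q3: "sqrt (c + 3 * \<delta>) + 3 * \<delta> \<le> q"
    using \<delta>(4) by (simp add: q_def field_simps)
  have q4: "48 * \<delta> \<le> 1 - q"
    using \<delta>(5) by simp
  have small: "48 * \<delta> / (1 - q) \<le> \<epsilon> / 2"
    using \<delta>(6) q by (simp add: pos_divide_le_eq)
  obtain \<rho> \<rho>1 \<rho>2 where \<rho>: "\<rho> > 0" "\<rho>1 > 0" "\<rho>2 > 0" "tangent_approx (M1 \<inter> M2) T A \<delta> \<rho>"
      "tangent_approx M1 T1 A \<delta> \<rho>1" "tangent_approx M2 T2 A \<delta> \<rho>2"
    using t(3)[OF \<delta>(1)] t1(3)[OF \<delta>(1)] t2(3)[OF \<delta>(1)] by blast
  define r where "r = min \<rho> (min \<rho>1 \<rho>2)"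
  have r: "r > 0" "r \<le> \<rho>" "r \<le> \<rho>1" "r \<le> \<rho>2"
    using \<rho> by (auto simp: r_def)
  show ?thesis
  proof (intro exI[of _ "r / 28"] conjI allI impI)
    show "r / 28 > 0"
      using r by simp
    fix B assume B: "norm (B - A) < r / 28"
    note res = alternating_projections_local[OF cl A t(1) t1(1) t2(1) TT
        tangent_approx_antimono[OF \<rho>(4) r(2)] tangent_approx_antimono[OF \<rho>(5) r(3)]
        tangent_approx_antimono[OF \<rho>(6) r(4)] \<delta>(1,2) r(1) c(1) angle q q3 q4 B]
    show "alt_proj_well_defined M1 M2 B"
      by (rule res(1))
    show "proj_well_defined (M1 \<inter> M2) B"
      by (rule res(2))
    obtain L where L: "L \<in> M1 \<inter> M2" "alt_proj M1 M2 B \<longlonglongrightarrow> L"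
      and le: "norm (L - closest_point (M1 \<inter> M2) B)
             \<le> 48 * \<delta> / (1 - q) * norm (B - closest_point (M1 \<inter> M2) B)"
      using res(3) by blast
    have "norm (L - closest_point (M1 \<inter> M2) B) < \<epsilon> * norm (B - closest_point (M1 \<inter> M2) B)"
      if "B \<notin> M1 \<inter> M2"
    proof -
      have "closest_point (M1 \<inter> M2) B \<in> M1 \<inter> M2"
        using closest_point_in_set[of "M1 \<inter> M2" B] cl A by blast
      then have pos: "norm (B - closest_point (M1 \<inter> M2) B) > 0"
        using that by auto
      \<comment> \<open>The slack between \<open>\<epsilon> / 2\<close> and
        \<open>\<epsilon>\<close>, with the positive distance of \<open>B\<close> from the
        intersection, makes the inequality strict.\<close>
      have "48 * \<delta> / (1 - q) < \<epsilon>"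
        using small \<open>\<epsilon> > 0\<close> by linarith
      then show ?thesis
        using le mult_strict_right_mono[OF _ pos] by fastforce
    qed
    then show "\<exists>B_inf \<in> M1 \<inter> M2. alt_proj M1 M2 B \<longlonglongrightarrow> B_inf \<and>
               (B \<notin> M1 \<inter> M2 \<longrightarrow>
                  norm (B_inf - closest_point (M1 \<inter> M2) B)
                    < \<epsilon> * norm (B - closest_point (M1 \<inter> M2) B))"
      using L by blast
  qed
qed

theorem theorem1p6:
  fixes M1 M2 :: "'a::euclidean_space set" and A :: 'a
  assumes "closed M1" and "closed M2"
    and "A \<in> M1 \<inter> M2"
    and "non_tangential 2 M1 M2 A"
  shows "(\<exists>s>0. \<forall>B. norm (B - A) < s \<longrightarrow>
            alt_proj_well_defined M1 M2 B \<and>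
            (\<exists>B_inf \<in> M1 \<inter> M2. alt_proj M1 M2 B \<longlonglongrightarrow> B_inf)) \<and>
         (\<forall>\<epsilon>>0. \<exists>s>0. \<forall>B. norm (B - A) < s \<longrightarrow>
            alt_proj_well_defined M1 M2 B \<and>
            proj_well_defined (M1 \<inter> M2) B \<and>
            (\<exists>B_inf \<in> M1 \<inter> M2. alt_proj M1 M2 B \<longlonglongrightarrow> B_inf \<and>
               (B \<notin> M1 \<inter> M2 \<longrightarrow>
                  norm (B_inf - closest_point (M1 \<inter> M2) B)
                    < \<epsilon> * norm (B - closest_point (M1 \<inter> M2) B))))"
proof (intro conjI allI impI)
  note eps = alternating_projections_epsilon[OF assms(1,2,4)]
  show "\<exists>s>0. \<forall>B. norm (B - A) < s \<longrightarrow>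
            alt_proj_well_defined M1 M2 B \<and>
            (\<exists>B_inf \<in> M1 \<inter> M2. alt_proj M1 M2 B \<longlonglongrightarrow> B_inf)"
    using eps[OF zero_less_one] by meson
qed (rule alternating_projections_epsilon[OF assms(1,2,4)])

end
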